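(* Assume hypotheses (D), (M) and (I) of the context. Let $T>0$, $r>0$, $t_0\in\mathbb{R}$, and let $\{\varepsilon_m\}_{m}\subset(0,\frac15]$ be a sequence decreasing to $0$ as $m\to\infty$. Let $\{u^m_0\}_m\subset\overline{B}_\gamma(0,r)$ be a sequence converging in $C_\gamma$ to $u_0\in C_\gamma$. Then, for any sequence $\{u^{\varepsilon_m}\}_m$ such that $u^{\varepsilon_m}$ is a solution of the sigmoidal equation $(S_{\varepsilon_m})$ with initial datum $u^{\varepsilon_m}_{t_0}=u^m_0$ at $t_0$, there is a subsequence $\{u^{\varepsilon_{m_k}}\}_k$ converging uniformly on $[t_0,t_0+T]$ to some $u^*\in C([t_0,t_0+T],\mathbb{R}^{n^2})$, and $u^*$ (extended to $(-\infty,t_0]$ by $u^*_{t_0}=u_0$) is a solution on $[t_0,t_0+T]$ of the Heaviside inclusion $(H_0)$ with initial datum $u^*_{t_0}=u_0$ at $t_0$.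
   Context: Let $n$ be a positive integer; $i,j,k$ range over $\{1,\dots,n\}$. Identify $\mathbb{R}^{n^2}$ with $\mathbb{R}^n\times\mathbb{R}^{n(n-1)}$, with elements $u=(x,z)=((x_i)_i,(z_{ij})_{i\ne j})$ and norm $\|u\|=\max\{\max_i|x_i|,\max_{i\neq j}|z_{ij}|\}$. Fix $\gamma>0$. $C_\gamma$ is the Banach space of continuous $u:(-\infty,0]\to\mathbb{R}^{n^2}$ for which $\lim_{t\to-\infty}e^{\gamma t}u(t)$ exists in $\mathbb{R}^{n^2}$, with norm $\|u\|_\gamma=\sup_{t\le0}e^{\gamma t}\|u(t)\|$; $\overline{B}_\gamma(0,r)=\{u\in C_\gamma:\|u\|_\gamma\le r\}$. The history at $t$ of a function $u$ is $u_t(s)=u(t+s)$, $s\le0$. Data: functions $A_i,B_{ij},I_i:\mathbb{R}\to\mathbb{R}$, constants $c_{ij},d_{ij}\ge0$, $\Gamma_i\in\mathbb{R}$, positive regular Borel measures $\mu_{ij}$ on $(-\infty,0]$ ($i\ne j$). $[s]^+=\max\{s,0\}$. Hypotheses: (D) all $A_i,B_{ij}$ are locally Lipschitz and there is $\alpha>0$ with $A_i(s)\ge\alpha$, $B_{ij}(s)\ge\alpha$ for all $s\in\mathbb{R}$. (M) $\int_{-\infty}^0e^{-\gamma t}\,d\mu_{ij}(t)<\infty$ for all $i\ne j$. (I) every $I_i$ is continuous. For $u=(x,z)\in C_\gamma$ and $t\in\mathbb{R}$: $D(u)=\big((-A_i(x_i(0))x_i(0))_i,(-B_{ij}(z_{ij}(0))z_{ij}(0))_{i\ne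 j}\big)$, $I(t)=((I_i(t))_i,0)$. With $\sigma_\varepsilon(s)=1/(1+e^{-s/\varepsilon})$, $\varepsilon>0$, $$\Sigma^\varepsilon(u)=\Big(\big(\textstyle\sum_{k\ne i}(z_{ki}(0)-c_{ki})\int_{-\infty}^0\sigma_\varepsilon(x_k(\tau)-\Gamma_k)\,d\mu_{ki}(\tau)\big)_i,\ \big(d_{ij}\int_{-\infty}^0\sigma_\varepsilon(x_i(\tau)-\Gamma_i)\,d\mu_{ij}(\tau)\,[x_j(0)]^+\big)_{i\ne j}\Big).$$ Equation $(S_\varepsilon)$: $u'(t)=D(u_t)+\Sigma^\varepsilon(u_t)+I(t)$, $t\ge t_0$. A solution with initial datum $u_0\in C_\gamma$ at $t_0$ is a continuous $u$ with $u_{t_0}=u_0$ satisfying the equation for $t\ge t_0$. Heaviside inclusion. Let $\chi(s)=\{0\}$ for $s<0$, $\chi(0)=[0,1]$, $\chi(s)=\{1\}$ for $s>0$. The Aumann integral of a measurable set-valued $F:(-\infty,0]\to\mathcal{P}(\mathbb{R})$ with respect to $\mu$ is $\int F\,d\mu=\{\int s\,d\mu: s \text{ a } \mu\text{-integrable selector of }F\}$. For $u=(x,z)\in C_\gamma$, $X^0(u)\subset\mathbb{R}^{n^2}$ is the Cartesian product of the sets $\sum_{k\ne i}(z_{ki}(0)-c_{ki})\int_{-\infty}^0\chi(x_k(\tau)-\Gamma_k)\,d\mu_{ki}(\tau)$ (component $x_i$; Minkowski sum) and $d_{ij}[x_j(0)]^+\int_{-\infty}^0\chi(x_i(\tau)-\Gamma_i)\,d\mu_{ij}(\tau)$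 (component $z_{ij}$). $(H_0)$ is $u'(t)\in D(u_t)+X^0(u_t)+I(t)$, $t\ge t_0$. A solution on $[t_0,t_0+T]$ with initial datum $u_0\in C_\gamma$ at $t_0$ is a function $u:(-\infty,t_0+T]\to\mathbb{R}^{n^2}$ with $u_{t_0}=u_0$, absolutely continuous on $[t_0,t_0+T]$, satisfying the inclusion for almost every $t\in[t_0,t_0+T]$. *)

theory Defs
  imports "HOL-Analysis.Analysis"
begin

section \<open>State space and phase space\<close>

text \<open>
  A point \<open>u = ((x\<^sub>i)\<^sub>i, (z\<^sub>i\<^sub>j)\<^sub>i\<^sub>\<noteq>\<^sub>j)\<close> of \<open>\<real>\<^sup>n \<times> \<real>\<^sup>n\<^sup>(\<^sup>n\<^sup>-\<^sup>1\<^sup>)\<close>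
  is stored as one \<open>n \<times> n\<close> array with the \<open>x\<^sub>i\<close> on the diagonal and the \<open>z\<^sub>i\<^sub>j\<close> off it.
  In this encoding \<^const>\<open>infnorm\<close> is the norm
  \<open>max {max\<^sub>i \<bar>x\<^sub>i\<bar>, max\<^sub>i\<^sub>\<noteq>\<^sub>j \<bar>z\<^sub>i\<^sub>j\<bar>}\<close>; the type-class norm is the Euclidean one, which is
  equivalent to it and is used only for topological notions.
\<close>

type_synonym 'n state = "real ^ 'n ^ 'n"

definition xc :: "'n::finite state \<Rightarrow> 'n \<Rightarrow> real" where
  "xc u i = u $ i $ i"

text \<open>Only meaningful for \<open>i \<noteq> j\<close>; every use below is guarded accordingly.\<close>

definition zc :: "'n::finite state \<Rightarrow> 'n \<Rightarrow> 'n \<Rightarrow> real" where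
  "zc u i j = u $ i $ j"

definition mk_state :: "('n::finite \<Rightarrow> real) \<Rightarrow> ('n \<Rightarrow> 'n \<Rightarrow> real) \<Rightarrow> 'n state" where
  "mk_state x z = (\<chi> i j. if i = j then x i else z i j)"

text \<open>
  Functions on \<open>(-\<infinity>, 0]\<close> are total functions of which only the restriction to
  \<^term>\<open>{..0::real}\<close> matters; the values at positive arguments are junk.
\<close>

definition C_space :: "real \<Rightarrow> (real \<Rightarrow> 'n::finite state) set" where
  "C_space \<gamma> = {u. continuous_on {..0} u \<and>
                   (\<exists>L. ((\<lambda>t. exp (\<gamma> * t) *\<^sub>R u t) \<longlongrightarrow> L) at_bot)}"

definition C_norm :: "real \<Rightarrow> (real \<Rightarrow> 'n::finite state) \<Rightarrow> real" where
  "C_norm \<gamma> u = (SUP t\<in>{..0}. exp (\<gamma> * t) * infnorm (u t))"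

definition C_cball :: "real \<Rightarrow> real \<Rightarrow> (real \<Rightarrow> 'n::finite state) set" where
  "C_cball \<gamma> r = {u \<in> C_space \<gamma>. C_norm \<gamma> u \<le> r}"

definition history :: "(real \<Rightarrow> 'n::finite state) \<Rightarrow> real \<Rightarrow> real \<Rightarrow> 'n state" where
  "history u t s = u (t + s)"


section \<open>Hypotheses on the data\<close>

definition locally_lipschitz :: "(real \<Rightarrow> real) \<Rightarrow> bool" where
  "locally_lipschitz f \<longleftrightarrow> (\<forall>s. \<exists>\<delta>>0. \<exists>L. L-lipschitz_on (cball s \<delta>) f)"

definition regular_borel_measure :: "real measure \<Rightarrow> bool" where
  "regular_borel_measure M \<longleftrightarrow>
     sets M = sets (restrict_space borel {..0}) \<and>
     (\<forall>S\<in>sets M.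
        emeasure M S = (INF U\<in>{U. openin (top_of_set {..0}) U \<and> S \<subseteq> U}. emeasure M U) \<and>
        emeasure M S = (SUP K\<in>{K. compact K \<and> K \<subseteq> S}. emeasure M K))"


section \<open>The sigmoidal equation\<close>

definition sigmoid :: "real \<Rightarrow> real \<Rightarrow> real" where
  "sigmoid \<epsilon> s = 1 / (1 + exp (- s / \<epsilon>))"

definition decay ::
  "('n::finite \<Rightarrow> real \<Rightarrow> real) \<Rightarrow> ('n \<Rightarrow> 'n \<Rightarrow> real \<Rightarrow> real) \<Rightarrow> (real \<Rightarrow> 'n state) \<Rightarrow> 'n state"
where
  "decay A B u = mk_state
     (\<lambda>i. - A i (xc (u 0) i) * xc (u 0) i)
     (\<lambda>i j. - B i j (zc (u 0) i j) * zc (u 0) i j)"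

definition input :: "('n::finite \<Rightarrow> real \<Rightarrow> real) \<Rightarrow> real \<Rightarrow> 'n state" where
  "input J t = mk_state (\<lambda>i. J i t) (\<lambda>i j. 0)"

text \<open>
  The measures live on \<open>(-\<infinity>, 0]\<close>, so the integrals below only see the arguments \<open>\<tau> \<le> 0\<close>.
\<close>

definition sigmoid_field ::
  "('n::finite \<Rightarrow> 'n \<Rightarrow> real) \<Rightarrow> ('n \<Rightarrow> 'n \<Rightarrow> real) \<Rightarrow> ('n \<Rightarrow> real) \<Rightarrow> ('n \<Rightarrow> 'n \<Rightarrow> real measure) \<Rightarrow>
   real \<Rightarrow> (real \<Rightarrow> 'n state) \<Rightarrow> 'n state"
where
  "sigmoid_field c d \<Gamma> \<mu> \<epsilon> u = mk_state
     (\<lambda>i. \<Sum>k\<in>UNIV - {i}. (zc (u 0) k i - c k i) *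
            (LINT \<tau>|\<mu> k i. sigmoid \<epsilon> (xc (u \<tau>) k - \<Gamma> k)))
     (\<lambda>i j. d i j * (LINT \<tau>|\<mu> i j. sigmoid \<epsilon> (xc (u \<tau>) i - \<Gamma> i)) * max (xc (u 0) j) 0)"

text \<open>At \<open>t = t0\<close> the derivative is one-sided.\<close>

definition sigmoid_solution ::
  "('n::finite \<Rightarrow> real \<Rightarrow> real) \<Rightarrow> ('n \<Rightarrow> 'n \<Rightarrow> real \<Rightarrow> real) \<Rightarrow> ('n \<Rightarrow> real \<Rightarrow> real) \<Rightarrow>
   ('n \<Rightarrow> 'n \<Rightarrow> real) \<Rightarrow> ('n \<Rightarrow> 'n \<Rightarrow> real) \<Rightarrow> ('n \<Rightarrow> real) \<Rightarrow> ('n \<Rightarrow> 'n \<Rightarrow> real measure) \<Rightarrow>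
   real \<Rightarrow> real \<Rightarrow> (real \<Rightarrow> 'n state) \<Rightarrow> (real \<Rightarrow> 'n state) \<Rightarrow> bool"
where
  "sigmoid_solution A B J c d \<Gamma> \<mu> \<epsilon> t0 u0 u \<longleftrightarrow>
     continuous_on UNIV u \<and>
     (\<forall>s\<le>0. history u t0 s = u0 s) \<and>
     (\<forall>t\<ge>t0. (u has_vector_derivative
        (decay A B (history u t) + sigmoid_field c d \<Gamma> \<mu> \<epsilon> (history u t) + input J t))
        (at t within {t0..}))"


section \<open>The Heaviside inclusion\<close>

definition heaviside :: "real \<Rightarrow> real set" where
  "heaviside s = (if s < 0 then {0} else if s = 0 then {0..1} else {1})"

definition aumann_integral :: "real measure \<Rightarrow> (real \<Rightarrow> real set) \<Rightarrow> real set" where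
  "aumann_integral M F =
     {integral\<^sup>L M s | s. integrable M s \<and> (\<forall>\<tau>\<in>space M. s \<tau> \<in> F \<tau>)}"

text \<open>
  Sets are added and scaled as in \<^theory>\<open>HOL-Library.Set_Algebras\<close>: \<open>+\<close> and \<open>\<Sum>\<close> are Minkowski
  sums (the empty sum being \<open>{0}\<close>), and \<open>a *o S = {a * s | s. s \<in> S}\<close>.
\<close>

definition heaviside_field ::
  "('n::finite \<Rightarrow> 'n \<Rightarrow> real) \<Rightarrow> ('n \<Rightarrow> 'n \<Rightarrow> real) \<Rightarrow> ('n \<Rightarrow> real) \<Rightarrow> ('n \<Rightarrow> 'n \<Rightarrow> real measure) \<Rightarrow>
   (real \<Rightarrow> 'n state) \<Rightarrow> 'n state set"
where
  "heaviside_field c d \<Gamma> \<mu> u =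
     {w. (\<forall>i. xc w i \<in> (\<Sum>k\<in>UNIV - {i}. (zc (u 0) k i - c k i) *o
                aumann_integral (\<mu> k i) (\<lambda>\<tau>. heaviside (xc (u \<tau>) k - \<Gamma> k)))) \<and>
         (\<forall>i j. i \<noteq> j \<longrightarrow> zc w i j \<in> (d i j * max (xc (u 0) j) 0) *o
                aumann_integral (\<mu> i j) (\<lambda>\<tau>. heaviside (xc (u \<tau>) i - \<Gamma> i)))}"

text \<open>
  The usual \<open>\<epsilon>\<close>-\<open>\<delta>\<close> notion for functions; the library's \<^const>\<open>absolutely_continuous\<close> is about
  measures. A pair \<open>(p, q) \<in> S\<close> stands for a subinterval \<open>[p, q]\<close>.
\<close>

definition absolutely_continuous_fun ::
  "real \<Rightarrow> real \<Rightarrow> (real \<Rightarrow> 'a::real_normed_vector) \<Rightarrow> bool"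
where
  "absolutely_continuous_fun a b f \<longleftrightarrow>
     (\<forall>e>0. \<exists>\<delta>>0. \<forall>S. finite S \<and>
        (\<forall>(p, q)\<in>S. a \<le> p \<and> p \<le> q \<and> q \<le> b) \<and>
        disjoint_family_on (\<lambda>(p, q). {p<..<q}) S \<and>
        (\<Sum>(p, q)\<in>S. q - p) < \<delta>
        \<longrightarrow> (\<Sum>(p, q)\<in>S. norm (f q - f p)) < e)"

text \<open>A solution is a function on \<open>(-\<infinity>, t0 + T]\<close>; its values to the right of \<open>t0 + T\<close> are junk.\<close>

definition heaviside_solution ::
  "('n::finite \<Rightarrow> real \<Rightarrow> real) \<Rightarrow> ('n \<Rightarrow> 'n \<Rightarrow> real \<Rightarrow> real) \<Rightarrow> ('n \<Rightarrow> real \<Rightarrow> real) \<Rightarrow>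
   ('n \<Rightarrow> 'n \<Rightarrow> real) \<Rightarrow> ('n \<Rightarrow> 'n \<Rightarrow> real) \<Rightarrow> ('n \<Rightarrow> real) \<Rightarrow> ('n \<Rightarrow> 'n \<Rightarrow> real measure) \<Rightarrow>
   real \<Rightarrow> real \<Rightarrow> (real \<Rightarrow> 'n state) \<Rightarrow> (real \<Rightarrow> 'n state) \<Rightarrow> bool"
where
  "heaviside_solution A B J c d \<Gamma> \<mu> t0 T u0 u \<longleftrightarrow>
     (\<forall>s\<le>0. history u t0 s = u0 s) \<and>
     absolutely_continuous_fun t0 (t0 + T) u \<and>
     (AE t in lebesgue. t \<in> {t0..t0 + T} \<longrightarrow>
        (\<exists>v. (u has_vector_derivative v) (at t within {t0..t0 + T}) \<and>
             v \<in> {decay A B (history u t)} + heaviside_field c d \<Gamma> \<mu> (history u t) + {input J t}))"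

end

theory Submission
  imports Defs "HOL-Complex_Analysis.Great_Picard"
begin

text \<open>
  The sigmoidal solutions are relatively compact on \<open>[t0, t0 + T]\<close> because their equations are controlled uniformly in
  \<open>\<epsilon>\<close>: the sigmoid terms grow at most linearly and the decay is dissipative, so a Gronwall argument gives
  a common bound and then a common Lipschitz constant
  (\<open>sigmoid_solutions_bounded_equi_Lipschitz\<close>). Arzela--Ascoli yields a uniformly convergent subsequence,
  whose limit \<open>ustar\<close> is Lipschitz, hence absolutely continuous, and differentiable almost everywhere
  (\<open>Lipschitz_differentiable_AE\<close>, proved with Vitali's covering theorem).

  The inclusion is then verified pointwise, at each time \<open>t\<close> at which \<open>ustar\<close> is differentiable.
  Fix an entry of the state. By the mean value theorem, the derivative of this entry of \<open>ustar\<close>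
  at \<open>t\<close> is a limit of derivatives of the same entry of sigmoidal solutions at times tending
  to \<open>t\<close> (\<open>derivative_of_limit_approximated\<close>), that is, of right-hand sides evaluated at histories
  that converge pointwise to the history of \<open>ustar\<close> at \<open>t\<close>. Along such histories the integrals of the sigmoids are
  bounded, and each of their cluster points lies between \<open>\<mu> {y > 0}\<close> and \<open>\<mu> {y \<ge> 0}\<close>, where \<open>y\<close> is the
  limiting argument of the sigmoid. These two numbers are the ends of the Aumann integral of the
  Heaviside map, which is an interval (\<open>sigmoid_integral_limit_in_aumann\<close>). Since the values of the Heaviside
  field are Cartesian products, treating the entries one at a time loses nothing
  (\<open>limit_derivative_in_inclusion\<close>).
\<close>

section \<open>Almost everywhere differentiability of Lipschitz functions\<close>

text \<open>
  Vitali's covering theorem on the line, phrased with endpoints instead of centres and radii so that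
  a condition \<open>P a b\<close> on the increment of a function over \<open>[a, b]\<close> can be imposed directly.
\<close>

lemma interval_cover_Vitali:
  fixes E U :: "real set"
  assumes E: "E \<subseteq> U" "open U"
    and fine: "\<And>x e. x \<in> E \<Longrightarrow> 0 < e \<Longrightarrow> \<exists>a b. P a b \<and> a < x \<and> x < b \<and> b - a < e"
  obtains C where "countable C" "\<And>a b. (a, b) \<in> C \<Longrightarrow> a < b \<and> P a b \<and> {a<..<b} \<subseteq> U"
    "disjoint_family_on (\<lambda>(a, b). {a<..<b}) C" "negligible (E - (\<Union>(a, b)\<in>C. {a<..<b}))"
proof -
  define K where "K = {i. fst i < snd i \<and> P (fst i) (snd i) \<and> {fst i<..<snd i} \<subseteq> U}"
  define m where "m i = (fst i + snd i) / 2" for i :: "real \<times> real"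
  define h where "h i = (snd i - fst i) / 2" for i :: "real \<times> real"
  have ball: "ball (m i) (h i) = {fst i<..<snd i}" for i
    by (auto simp: m_def h_def dist_real_def field_simps abs_less_iff)
  have "\<exists>i. i \<in> K \<and> x \<in> ball (m i) (h i) \<and> h i < e" if x: "x \<in> E" "0 < e" for x e
  proof -
    obtain \<rho> where \<rho>: "\<rho> > 0" "ball x \<rho> \<subseteq> U"
      using E x openE by blast
    obtain a b where ab: "P a b" "a < x" "x < b" "b - a < min \<rho> (2 * e)"
      using fine[OF x(1), of "min \<rho> (2 * e)"] \<rho> x by auto
    have "{a<..<b} \<subseteq> ball x \<rho>"
      using ab by (auto simp: dist_real_def)
    then have "(a, b) \<in> K \<and> x \<in> ball (m (a, b)) (h (a, b)) \<and> h (a, b) < e"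
      unfolding ball using ab \<rho> by (auto simp: K_def h_def)
    then show ?thesis by blast
  qed
  then obtain C where C: "countable C" "C \<subseteq> K"
     "pairwise (\<lambda>i j. disjnt (ball (m i) (h i)) (ball (m j) (h j))) C"
     "negligible (E - (\<Union>i\<in>C. ball (m i) (h i)))"
    using Vitali_covering_theorem_balls[of E K m h] by blast
  show thesis
  proof (rule that[of C])
    show "disjoint_family_on (\<lambda>(a, b). {a<..<b}) C"
      using C(3) unfolding disjoint_family_on_def pairwise_def disjnt_def ball by (auto simp: case_prod_unfold)
    show "negligible (E - (\<Union>(a, b)\<in>C. {a<..<b}))"
      using C(4) unfolding ball by (simp add: case_prod_unfold)
    show "a < b \<and> P a b \<and> {a<..<b} \<subseteq> U" if "(a, b) \<in> C" for a b
      using C(2) that unfolding K_def by (metis (mono_tags, lifting) fst_conv mem_Collect_eq snd_conv subsetD)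
  qed (use C in auto)
qed

lemma emeasure_countable_intervals:
  fixes C :: "(real \<times> real) set" and M :: "real measure"
  assumes "countable C" "disjoint_family_on (\<lambda>(a, b). {a<..<b}) C" "sets M = sets borel"
  shows "emeasure M (\<Union>(a, b)\<in>C. {a<..<b}) = (\<integral>\<^sup>+ (a, b). emeasure M {a<..<b} \<partial>count_space C)"
  using emeasure_UN_countable[of C "\<lambda>(a, b). {a<..<b}" M] assms
  by (auto simp: case_prod_unfold)

lemma emeasure_interval_measure_Ioo:
  assumes mono: "mono F" and cont: "continuous_on UNIV F" and "a \<le> b"
  shows "emeasure (interval_measure F) {a<..<b} = ennreal (F b - F a)"
proof -
  have m: "\<And>x y. x \<le> y \<Longrightarrow> F x \<le> F y" using mono by (auto simp: mono_def)
  have "emeasure (interval_measure F) {x} = 0" for x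
    using emeasure_interval_measure_Icc[OF _ m cont, of x x] by simp
  then have "{a} \<in> null_sets (interval_measure F)" "{b} \<in> null_sets (interval_measure F)"
    by (auto simp: null_sets_def)
  then have "{a} \<union> {b} \<in> null_sets (interval_measure F)"
    by (rule null_sets.Un)
  then have "emeasure (interval_measure F) ({a<..<b} \<union> ({a} \<union> {b})) = emeasure (interval_measure F) {a<..<b}"
    by (intro emeasure_Un_null_set) auto
  also have "{a<..<b} \<union> ({a} \<union> {b}) = {a..b}"
    using \<open>a \<le> b\<close> by auto
  finally have "emeasure (interval_measure F) {a<..<b} = emeasure (interval_measure F) {a..b}" ..
  then show ?thesis
    by (simp add: emeasure_interval_measure_Icc[OF \<open>a \<le> b\<close> m cont])
qed

text \<open>
  Write \<open>\<nu>\<close> for the Stieltjes measure of \<open>f\<close> and \<open>\<lambda>\<close> for Lebesgue measure. Two nested Vitali covers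
  compare the slopes: inside an open \<open>U \<supseteq> E\<close> of almost the same measure, intervals of slope at most
  \<open>p\<close> cover almost all of \<open>E\<close> by an open \<open>V\<close>; inside \<open>V\<close>, intervals of slope at least \<open>q\<close> cover almost
  all of \<open>E\<close> by \<open>W\<close>. Then \<open>q \<lambda>(E) \<le> q \<lambda>(W) \<le> \<nu>(W) \<le> \<nu>(V) \<le> p \<lambda>(V) \<le> p (\<lambda>(E) + e)\<close>,
  and \<open>p < q\<close> leaves only \<open>\<lambda>(E) = 0\<close>. Because the covers are nested, the step from \<open>\<nu>(W)\<close> to
  \<open>\<nu>(V)\<close> is monotonicity.
\<close>

lemma negligible_oscillating_slope:
  fixes f :: "real \<Rightarrow> real" and p q :: real
  assumes mono: "mono f" and cont: "continuous_on UNIV f" and pq: "0 \<le> p" "p < q"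
    and E: "E \<in> sets borel" "emeasure lborel E < \<infinity>"
    and lo: "\<And>x e. x \<in> E \<Longrightarrow> 0 < e \<Longrightarrow> \<exists>a b. f b - f a \<le> p * (b - a) \<and> a < x \<and> x < b \<and> b - a < e"
    and hi: "\<And>x e. x \<in> E \<Longrightarrow> 0 < e \<Longrightarrow> \<exists>a b. q * (b - a) \<le> f b - f a \<and> a < x \<and> x < b \<and> b - a < e"
  shows "negligible E"
proof -
  let ?\<nu> = "interval_measure f"
  have \<nu>: "emeasure ?\<nu> {a<..<b} = ennreal (f b - f a)" if "a \<le> b" for a b
    by (rule emeasure_interval_measure_Ioo[OF mono cont that])
  have bound: "ennreal q * emeasure lborel E \<le> ennreal p * emeasure lborel E + ennreal p * ennreal e"
    if "e > 0" for e :: real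
  proof -
    obtain U where U: "open U" "E \<subseteq> U" "emeasure lebesgue (U - E) < ennreal e"
      using sets_lebesgue_outer_open[of E e] E \<open>e > 0\<close> by auto
    obtain C where C: "countable C" "\<And>a b. (a, b) \<in> C \<Longrightarrow> a < b \<and> f b - f a \<le> p * (b - a) \<and> {a<..<b} \<subseteq> U"
      "disjoint_family_on (\<lambda>(a, b). {a<..<b}) C" "negligible (E - (\<Union>(a, b)\<in>C. {a<..<b}))"
      by (rule interval_cover_Vitali[OF U(2,1), of "\<lambda>a b. f b - f a \<le> p * (b - a)"])
        (use lo in blast)+
    define V where "V = (\<Union>(a, b)\<in>C. {a<..<b})"
    have V: "open V" by (auto simp: V_def)
    obtain C' where C': "countable C'" "\<And>a b. (a, b) \<in> C' \<Longrightarrow> a < b \<and> q * (b - a) \<le> f b - f a \<and> {a<..<b} \<subseteq> V"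
      "disjoint_family_on (\<lambda>(a, b). {a<..<b}) C'" "negligible (E \<inter> V - (\<Union>(a, b)\<in>C'. {a<..<b}))"
      by (rule interval_cover_Vitali[of "E \<inter> V" V "\<lambda>a b. q * (b - a) \<le> f b - f a"])
        (use hi V in blast)+
    define W where "W = (\<Union>(a, b)\<in>C'. {a<..<b})"
    have W: "open W" "W \<subseteq> V" using C'(2) by (auto simp: W_def)
    have "negligible (E - W)"
      using negligible_Un[OF C(4) C'(4)] by (rule negligible_subset) (auto simp: W_def V_def)
    then have "emeasure lborel (E - W) = 0"
      using E W by (simp add: negligible_iff_null_sets null_sets_completion_iff null_sets_def)
    then have "emeasure lborel E \<le> emeasure lborel W"
      using E W emeasure_mono[of E "W \<union> (E - W)" lborel] emeasure_Un_null_set[of W lborel "E - W"]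
      by (auto simp: null_sets_def)
    then have "ennreal q * emeasure lborel E \<le> ennreal q * emeasure lborel W"
      by (rule mult_left_mono) simp
    also have "\<dots> = (\<integral>\<^sup>+ (a, b). ennreal q * emeasure lborel {a<..<b} \<partial>count_space C')"
      unfolding W_def emeasure_countable_intervals[OF C'(1,3) sets_lborel]
      by (subst nn_integral_cmult[symmetric]) (auto simp: case_prod_unfold)
    also have "\<dots> \<le> (\<integral>\<^sup>+ (a, b). emeasure ?\<nu> {a<..<b} \<partial>count_space C')"
    proof (intro nn_integral_mono, clarsimp)
      fix a b assume "(a, b) \<in> C'"
      then have "a < b" "q * (b - a) \<le> f b - f a" using C'(2) by auto
      then show "ennreal q * emeasure lborel {a<..<b} \<le> emeasure ?\<nu> {a<..<b}"
        using pq by (simp add: \<nu> ennreal_mult[symmetric] ennreal_leI)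
    qed
    also have "\<dots> = emeasure ?\<nu> W"
      unfolding W_def by (rule emeasure_countable_intervals[symmetric]) (use C' in auto)
    also have "\<dots> \<le> emeasure ?\<nu> V"
      using W V by (intro emeasure_mono) auto
    also have "\<dots> = (\<integral>\<^sup>+ (a, b). emeasure ?\<nu> {a<..<b} \<partial>count_space C)"
      unfolding V_def by (rule emeasure_countable_intervals) (use C in auto)
    also have "\<dots> \<le> (\<integral>\<^sup>+ (a, b). ennreal p * emeasure lborel {a<..<b} \<partial>count_space C)"
    proof (intro nn_integral_mono, clarsimp)
      fix a b assume "(a, b) \<in> C"
      then have "a < b" "f b - f a \<le> p * (b - a)" using C(2) by auto
      then show "emeasure ?\<nu> {a<..<b} \<le> ennreal p * emeasure lborel {a<..<b}"
        using pq by (simp add: \<nu> ennreal_mult[symmetric] ennreal_leI)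
    qed
    also have "\<dots> = ennreal p * emeasure lborel V"
      unfolding V_def emeasure_countable_intervals[OF C(1,3) sets_lborel]
      by (subst nn_integral_cmult[symmetric]) (auto simp: case_prod_unfold)
    also have "\<dots> \<le> ennreal p * (emeasure lborel E + ennreal e)"
    proof (rule mult_left_mono)
      have "V \<subseteq> U" using C(2) by (force simp: V_def)
      then have "emeasure lborel V \<le> emeasure lborel U" using U by (intro emeasure_mono) auto
      also have "\<dots> \<le> emeasure lborel (E \<union> (U - E))" using U E by (intro emeasure_mono) auto
      also have "\<dots> \<le> emeasure lborel E + emeasure lborel (U - E)"
        using U E by (intro emeasure_subadditive) auto
      also have "\<dots> \<le> emeasure lborel E + ennreal e"
        using U E by (intro add_left_mono) (auto simp: less_imp_le)
      finally show "emeasure lborel V \<le> emeasure lborel E + ennreal e" .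
    qed simp
    finally show ?thesis by (simp add: distrib_left)
  qed
  have e: "emeasure lborel E = ennreal (measure lborel E)"
    using E(2) by (simp add: emeasure_eq_ennreal_measure top.not_eq_extremum)
  have "q * measure lborel E \<le> p * measure lborel E + p * e" if "e > 0" for e
    using bound[OF that] pq that unfolding e
    by (simp add: ennreal_mult[symmetric] ennreal_plus[symmetric] del: ennreal_plus)
  then have "(q - p) * measure lborel E \<le> 0"
  proof -
    have "((\<lambda>e. p * measure lborel E + p * e) \<longlongrightarrow> p * measure lborel E + p * 0) (at_right 0)"
      by (intro tendsto_intros)
    then have "q * measure lborel E \<le> p * measure lborel E + p * 0"
      by (rule tendsto_lowerbound) 
         (use \<open>\<And>e. e > 0 \<Longrightarrow> q * measure lborel E \<le> p * measure lborel E + p * e\<close> in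
          \<open>auto simp: eventually_at_right_field intro!: exI[of _ 1]\<close>)
    then show ?thesis by (simp add: algebra_simps)
  qed
  then have "measure lborel E = 0"
    using pq by (auto simp: mult_le_0_iff order.antisym)
  then show ?thesis
    using E e by (auto simp: negligible_iff_null_sets null_sets_completion_iff null_sets_def)
qed

text \<open>
  Slopes are taken over intervals that contain the point in their interior. This makes the
  exceptional set a countable intersection of open sets, hence Borel; one-sided difference quotients
  would not give this for free. The truncation to \<open>[-n, n]\<close> supplies finite measure.
\<close>

lemma negligible_oscillating_slope_set:
  fixes f :: "real \<Rightarrow> real" and p q :: real
  assumes mono: "mono f" and cont: "continuous_on UNIV f" and pq: "0 \<le> p" "p < q"
  shows "negligible {x. \<forall>e>0. (\<exists>a b. f b - f a \<le> p * (b - a) \<and> a < x \<and> x < b \<and> b - a < e) \<and>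
                              (\<exists>a b. q * (b - a) \<le> f b - f a \<and> a < x \<and> x < b \<and> b - a < e)}"
    (is "negligible ?E")
proof -
  define L where "L e = {x. \<exists>a b. f b - f a \<le> p * (b - a) \<and> a < x \<and> x < b \<and> b - a < e}" for e
  define H where "H e = {x. \<exists>a b. q * (b - a) \<le> f b - f a \<and> a < x \<and> x < b \<and> b - a < e}" for e
  have "open (L e)" "open (H e)" for e
    unfolding L_def H_def
    by (intro open_Collect_ex open_Collect_conj open_Collect_less open_Collect_const continuous_intros)+
  then have borel: "(\<Inter>n. L (1 / Suc n) \<inter> H (1 / Suc n)) \<in> sets borel"
    by (intro sets.countable_INT'') auto
  have "?E = (\<Inter>n. L (1 / Suc n) \<inter> H (1 / Suc n))"
  proof -
    have L_iff: "x \<in> L e \<longleftrightarrow> (\<exists>a b. f b - f a \<le> p * (b - a) \<and> a < x \<and> x < b \<and> b - a < e)" for x e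
      by (auto simp: L_def)
    have H_iff: "x \<in> H e \<longleftrightarrow> (\<exists>a b. q * (b - a) \<le> f b - f a \<and> a < x \<and> x < b \<and> b - a < e)" for x e
      by (auto simp: H_def)
    have mono_LH: "L e \<inter> H e \<subseteq> L e' \<inter> H e'" if "e \<le> e'" for e e'
      using that unfolding subset_iff Int_iff L_iff H_iff by (meson less_le_trans)
    have "(\<forall>e>0. x \<in> L e \<inter> H e) \<longleftrightarrow> (\<forall>n. x \<in> L (1 / Suc n) \<inter> H (1 / Suc n))" for x
    proof
      assume x: "\<forall>n. x \<in> L (1 / Suc n) \<inter> H (1 / Suc n)"
      show "\<forall>e>0. x \<in> L e \<inter> H e"
      proof (intro allI impI)
        fix e :: real assume "e > 0"
        then obtain n where "1 / real (Suc n) < e" using nat_approx_posE by blast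
        with x mono_LH[of "1 / Suc n" e] show "x \<in> L e \<inter> H e"
          by (meson less_imp_le subsetD)
      qed
    qed auto
    then show ?thesis by (auto simp: L_iff[symmetric] H_iff[symmetric])
  qed
  with borel have meas: "?E \<in> sets borel" by simp
  have "negligible (?E \<inter> {- real n..real n})" for n
  proof (rule negligible_oscillating_slope[OF mono cont pq])
    show "?E \<inter> {- real n..real n} \<in> sets borel" using meas by (rule sets.Int) auto
    have "emeasure lborel (?E \<inter> {- real n..real n}) \<le> emeasure lborel {- real n..real n}"
      by (rule emeasure_mono) auto
    also have "\<dots> < \<infinity>" by simp
    finally show "emeasure lborel (?E \<inter> {- real n..real n}) < \<infinity>" .
  qed auto
  then have "negligible (\<Union>n. ?E \<inter> {- real n..real n})" by (intro negligible_countable_Union) auto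
  also have "(\<Union>n. ?E \<inter> {- real n..real n}) = ?E"
  proof -
    have "\<exists>n. x \<in> {- real n..real n}" for x :: real
      using real_arch_simple[of "\<bar>x\<bar>"] by (auto simp: abs_le_iff minus_le_iff)
    then have "(\<Union>n. {- real n..real n}) = UNIV" by blast
    then show ?thesis unfolding Int_UN_distrib[symmetric] by simp
  qed
  finally show ?thesis .
qed

text \<open>
  Letting the endpoint on one side of \<open>x\<close> tend to \<open>x\<close> turns slopes over surrounding intervals into
  ordinary difference quotients; continuity at \<open>x\<close> is what permits this.
\<close>

lemma differentiable_if_straddled_slopes_converge:
  fixes f :: "real \<Rightarrow> real"
  assumes cont: "isCont f x"
    and slope: "\<And>\<eta>. 0 < \<eta> \<Longrightarrow> \<exists>\<delta>>0. \<forall>a b. a < x \<and> x < b \<and> b - a < \<delta> \<longrightarrow>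
                  \<bar>f b - f a - D * (b - a)\<bar> \<le> \<eta> * (b - a)"
  shows "(f has_real_derivative D) (at x)"
proof -
  have "(f has_derivative (\<lambda>h. h * D)) (at x)"
    unfolding has_derivative_at_alt
  proof (intro conjI allI impI bounded_linear_mult_left)
    fix \<eta> :: real assume "\<eta> > 0"
    then obtain \<delta> where \<delta>: "\<delta> > 0" "\<And>a b. a < x \<Longrightarrow> x < b \<Longrightarrow> b - a < \<delta> \<Longrightarrow>
       \<bar>f b - f a - D * (b - a)\<bar> \<le> \<eta> * (b - a)"
      using slope by meson
    have lim: "((\<lambda>a. f a) \<longlongrightarrow> f x) (at_left x)" "((\<lambda>a. f a) \<longlongrightarrow> f x) (at_right x)"
      using cont by (auto simp: isCont_def filterlim_at_split)
    have "norm (f y - f x - (y - x) * D) \<le> \<eta> * norm (y - x)" if "norm (y - x) < \<delta>" for y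
    proof (cases y x rule: linorder_cases)
      case greater
      have "((\<lambda>a. \<eta> * (y - a) - \<bar>f y - f a - D * (y - a)\<bar>) \<longlongrightarrow> \<eta> * (y - x) - \<bar>f y - f x - D * (y - x)\<bar>) (at_left x)"
        by (intro tendsto_intros lim)
      moreover have "\<forall>\<^sub>F a in at_left x. 0 \<le> \<eta> * (y - a) - \<bar>f y - f a - D * (y - a)\<bar>"
        unfolding eventually_at_left_field using greater that \<delta>
        by (intro exI[of _ "y - \<delta>"]) auto
      ultimately have "0 \<le> \<eta> * (y - x) - \<bar>f y - f x - D * (y - x)\<bar>"
        by (rule tendsto_lowerbound) simp
      then show ?thesis using greater by (simp add: mult.commute)
    next
      case less
      have "((\<lambda>b. \<eta> * (b - y) - \<bar>f b - f y - D * (b - y)\<bar>) \<longlongrightarrow> \<eta> * (x - y) - \<bar>f x - f y - D * (x - y)\<bar>) (at_right x)"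
        by (intro tendsto_intros lim)
      moreover have "\<forall>\<^sub>F b in at_right x. 0 \<le> \<eta> * (b - y) - \<bar>f b - f y - D * (b - y)\<bar>"
        unfolding eventually_at_right_field using less that \<delta>
        by (intro exI[of _ "y + \<delta>"]) auto
      ultimately have "0 \<le> \<eta> * (x - y) - \<bar>f x - f y - D * (x - y)\<bar>"
        by (rule tendsto_lowerbound) simp
      moreover have "\<bar>f x - f y - D * (x - y)\<bar> = \<bar>f y - f x - (y - x) * D\<bar>"
        by (subst abs_minus_commute) (simp add: algebra_simps)
      ultimately show ?thesis using less by simp
    qed simp
    then show "\<exists>d>0. \<forall>y. norm (y - x) < d \<longrightarrow> norm (f y - f x - (y - x) * D) \<le> \<eta> * norm (y - x)"
      using \<delta>(1) by blast
  qed
  then show ?thesis by (simp add: has_field_derivative_def mult_commute_abs)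
qed

text \<open>
  Outside the null set where the slopes oscillate across some pair of rationals, the lower limit \<open>D\<close> of
  the slopes at \<open>x\<close> (finite because of the Lipschitz bound) is also their upper limit.
\<close>

lemma mono_Lipschitz_differentiable_AE:
  fixes f :: "real \<Rightarrow> real"
  assumes mono: "mono f" and lip: "L-lipschitz_on UNIV f"
  shows "AE x in lebesgue. f differentiable (at x)"
proof -
  have cont: "continuous_on UNIV f" by (rule lipschitz_on_continuous_on[OF lip])
  have incr: "f b - f a \<le> L * (b - a)" if "a < b" for a b
    using lipschitz_onD[OF lip, of b a] that by (simp add: dist_real_def)
  have L: "L \<ge> 0" by (rule lipschitz_on_nonneg[OF lip])
  define E where "E pq = {x. \<forall>e>0. (\<exists>a b. f b - f a \<le> fst pq * (b - a) \<and> a < x \<and> x < b \<and> b - a < e) \<and>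
                              (\<exists>a b. snd pq * (b - a) \<le> f b - f a \<and> a < x \<and> x < b \<and> b - a < e)}"
    for pq :: "real \<times> real"
  define Q where "Q = {pq :: real \<times> real. pq \<in> \<rat> \<times> \<rat> \<and> 0 \<le> fst pq \<and> fst pq < snd pq}"
  have "countable Q"
    by (rule countable_subset[of _ "\<rat> \<times> \<rat>"]) (auto simp: Q_def intro: countable_rat)
  then have "negligible (\<Union>pq\<in>Q. E pq)"
    unfolding E_def using negligible_oscillating_slope_set[OF mono cont]
    by (intro negligible_countable_Union countable_image) (auto simp: Q_def)
  then have "AE x in lebesgue. x \<notin> (\<Union>pq\<in>Q. E pq)"
    unfolding negligible_iff_null_sets by (rule AE_not_in)
  then show ?thesis
  proof (rule AE_mp, intro AE_I2 impI)
    fix x assume x: "x \<notin> (\<Union>pq\<in>Q. E pq)"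
    \<comment> \<open>the slopes that are undercut on arbitrarily small intervals around \<open>x\<close>\<close>
    define S where "S = {p. 0 \<le> p \<and> (\<forall>e>0. \<exists>a b. f b - f a \<le> p * (b - a) \<and> a < x \<and> x < b \<and> b - a < e)}"
    define D where "D = Inf S"
    have LS: "L \<in> S"
    proof -
      have "\<exists>a b. f b - f a \<le> L * (b - a) \<and> a < x \<and> x < b \<and> b - a < e" if "e > 0" for e
        using incr[of "x - e / 3" "x + e / 3"] that
        by (intro exI[of _ "x - e / 3"] exI[of _ "x + e / 3"]) auto
      then show ?thesis using L by (auto simp: S_def)
    qed
    have bdd: "bdd_below S" by (auto simp: S_def bdd_below_def)
    have up: "q \<in> S" if "p \<in> S" "p \<le> q" for p q
    proof -
      have step: "f b - f a \<le> q * (b - a)" if "f b - f a \<le> p * (b - a)" "a < x" "x < b" for a b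
        using that mult_right_mono[OF \<open>p \<le> q\<close>, of "b - a"] by linarith
      have "\<exists>a b. f b - f a \<le> q * (b - a) \<and> a < x \<and> x < b \<and> b - a < e" if "e > 0" for e
      proof -
        obtain a b where "f b - f a \<le> p * (b - a)" "a < x" "x < b" "b - a < e"
          using \<open>p \<in> S\<close> \<open>e > 0\<close> unfolding S_def by blast
        then show ?thesis using step by blast
      qed
      moreover have "0 \<le> q" using that by (simp add: S_def)
      ultimately show ?thesis by (simp add: S_def)
    qed
    have below: "\<exists>\<delta>>0. \<forall>a b. a < x \<and> x < b \<and> b - a < \<delta> \<longrightarrow> p * (b - a) \<le> f b - f a" if "p < D" for p
    proof (cases "p < 0")
      case True
      have "p * (b - a) \<le> f b - f a" if "a < b" for a b
        using True that monoD[OF mono, of a b] mult_nonpos_nonneg[of p "b - a"] by linarith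
      then show ?thesis by (intro exI[of _ 1]) auto
    next
      case False
      have "p \<notin> S" using that cInf_lower[OF _ bdd, of p] by (auto simp: D_def)
      then obtain \<delta> where "\<delta> > 0" "\<And>a b. a < x \<Longrightarrow> x < b \<Longrightarrow> b - a < \<delta> \<Longrightarrow> \<not> f b - f a \<le> p * (b - a)"
        using False unfolding S_def by auto
      then show ?thesis by (meson less_imp_le not_le)
    qed
    have above: "\<exists>\<delta>>0. \<forall>a b. a < x \<and> x < b \<and> b - a < \<delta> \<longrightarrow> f b - f a \<le> q * (b - a)" if Dq: "D < q" for q
    proof -
      obtain p' where p': "p' \<in> S" "p' < q"
        using cInf_lessD[of S q] Dq LS unfolding D_def by blast
      obtain p1 where p1: "p1 \<in> \<rat>" "p' < p1" "p1 < q" using Rats_dense_in_real[OF p'(2)] by auto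
      obtain q1 where q1: "q1 \<in> \<rat>" "p1 < q1" "q1 < q" using Rats_dense_in_real[OF p1(3)] by auto
      have "p1 \<in> S" using up[OF p'(1)] p1 by simp
      then have "0 \<le> p1" by (simp add: S_def)
      then have "(p1, q1) \<in> Q" using p1 q1 by (simp add: Q_def)
      then have "x \<notin> E (p1, q1)" using x by blast
      then obtain \<delta> where \<delta>: "\<delta> > 0" "\<And>a b. a < x \<Longrightarrow> x < b \<Longrightarrow> b - a < \<delta> \<Longrightarrow> \<not> q1 * (b - a) \<le> f b - f a"
        using \<open>p1 \<in> S\<close> unfolding E_def S_def by auto
      have "f b - f a \<le> q * (b - a)" if "a < x" "x < b" "b - a < \<delta>" for a b
        using \<delta>(2)[OF that] mult_right_mono[of q1 q "b - a"] q1 that by linarith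
      then show ?thesis using \<delta>(1) by blast
    qed
    have "(f has_real_derivative D) (at x)"
    proof (rule differentiable_if_straddled_slopes_converge)
      show "isCont f x" using cont by (simp add: continuous_on_eq_continuous_at)
      fix \<eta> :: real assume "\<eta> > 0"
      then obtain \<delta>1 \<delta>2 where d: "\<delta>1 > 0" "\<delta>2 > 0"
        "\<And>a b. a < x \<Longrightarrow> x < b \<Longrightarrow> b - a < \<delta>1 \<Longrightarrow> (D - \<eta>) * (b - a) \<le> f b - f a"
        "\<And>a b. a < x \<Longrightarrow> x < b \<Longrightarrow> b - a < \<delta>2 \<Longrightarrow> f b - f a \<le> (D + \<eta>) * (b - a)"
        using below[of "D - \<eta>"] above[of "D + \<eta>"] by auto
      have "\<bar>f b - f a - D * (b - a)\<bar> \<le> \<eta> * (b - a)" if "a < x" "x < b" "b - a < min \<delta>1 \<delta>2" for a b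
        using d(3)[of a b] d(4)[of a b] that by (auto simp: abs_le_iff algebra_simps)
      then show "\<exists>\<delta>>0. \<forall>a b. a < x \<and> x < b \<and> b - a < \<delta> \<longrightarrow> \<bar>f b - f a - D * (b - a)\<bar> \<le> \<eta> * (b - a)"
        using d(1,2) by (intro exI[of _ "min \<delta>1 \<delta>2"]) auto
    qed
    then show "f differentiable (at x)"
      by (auto simp: real_differentiable_def)
  qed
qed

text \<open>
  Rademacher's theorem on an interval. Each coordinate, extended constantly beyond \<open>[a, b]\<close>, becomes
  nondecreasing after adding the linear function with slope \<open>L\<close>.
\<close>

lemma Lipschitz_differentiable_AE:
  fixes f :: "real \<Rightarrow> 'a::euclidean_space"
  assumes lip: "L-lipschitz_on {a..b} f"
  shows "AE t in lebesgue. t \<in> {a..b} \<longrightarrow> f differentiable (at t within {a..b})"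
proof (cases "a \<le> b")
  case True
  define F where "F e t = f (max a (min t b)) \<bullet> e" for e t
  have L: "L \<ge> 0" by (rule lipschitz_on_nonneg[OF lip])
  have F: "\<bar>F e s - F e t\<bar> \<le> L * \<bar>s - t\<bar>" if "e \<in> Basis" for e s t
  proof -
    let ?s = "max a (min s b)" and ?t = "max a (min t b)"
    have "\<bar>F e s - F e t\<bar> \<le> norm (f ?s - f ?t)"
      using Basis_le_norm[OF that, of "f ?s - f ?t"] by (simp add: F_def inner_diff_left)
    also have "\<dots> \<le> L * \<bar>?s - ?t\<bar>"
      using lipschitz_onD[OF lip, of ?s ?t] True by (simp add: dist_norm)
    also have "\<dots> \<le> L * \<bar>s - t\<bar>"
      using L by (intro mult_left_mono) auto
    finally show ?thesis .
  qed
  have "AE t in lebesgue. F e differentiable (at t)" if e: "e \<in> Basis" for e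
  proof -
    have "mono (\<lambda>t. F e t + L * t)"
    proof (rule monoI)
      fix s t :: real assume "s \<le> t"
      then show "F e s + L * s \<le> F e t + L * t" using F[OF e, of s t] by (simp add: algebra_simps abs_le_iff)
    qed
    moreover have "(2 * L)-lipschitz_on UNIV (\<lambda>t. F e t + L * t)"
    proof (rule lipschitz_onI)
      fix s t :: real
      have "\<bar>F e s + L * s - (F e t + L * t)\<bar> \<le> \<bar>F e s - F e t\<bar> + \<bar>L * (s - t)\<bar>"
        by (simp add: algebra_simps)
      then show "dist (F e s + L * s) (F e t + L * t) \<le> 2 * L * dist s t"
        using F[OF e, of s t] L by (simp add: dist_real_def abs_mult)
    qed (use L in simp)
    ultimately have "AE t in lebesgue. (\<lambda>t. F e t + L * t) differentiable (at t)"
      by (rule mono_Lipschitz_differentiable_AE)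
    then show ?thesis
    proof (rule AE_mp, intro AE_I2 impI)
      fix t assume "(\<lambda>t. F e t + L * t) differentiable (at t)"
      then have "(\<lambda>t. (F e t + L * t) - L * t) differentiable (at t)"
        by (rule differentiable_diff) simp
      then show "F e differentiable (at t)" by simp
    qed
  qed
  then have "AE t in lebesgue. \<forall>e\<in>Basis. F e differentiable (at t)"
    by (intro AE_finite_allI) auto
  then show ?thesis
  proof (rule AE_mp, intro AE_I2 impI)
    fix t :: real assume t: "\<forall>e\<in>Basis. F e differentiable (at t)" "t \<in> {a..b}"
    show "f differentiable (at t within {a..b})"
    proof (rule differentiable_componentwise_within[THEN iffD2, rule_format])
      fix e :: 'a assume "e \<in> Basis"
      with t(1) have "F e differentiable (at t)" by blast
      then have "F e differentiable (at t within {a..b})" by (rule differentiable_at_withinI)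
      then show "(\<lambda>s. f s \<bullet> e) differentiable (at t within {a..b})"
        by (rule differentiable_transform_within[where d = 1]) (use t(2) in \<open>auto simp: F_def\<close>)
    qed
  qed
next
  case False
  then have "{a..b} = {}" by simp
  then show ?thesis by simp
qed

section \<open>Sigmoid integrals and the Aumann integral of the Heaviside map\<close>

lemma sigmoid_nonneg: "0 \<le> sigmoid e s"
  by (simp add: sigmoid_def add_nonneg_nonneg)

lemma sigmoid_le_1: "sigmoid e s \<le> 1"
  by (simp add: sigmoid_def divide_le_eq add_pos_pos)

lemma sigmoid_minus: "sigmoid e (- s) = 1 - sigmoid e s"
proof -
  have "1 / (1 + x) = 1 - 1 / (1 + 1 / x)" if "x > 0" for x :: real
    using that add_pos_pos[of 1 x] by (simp add: divide_simps)
  from this[of "exp (s / e)"] show ?thesis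
    by (simp add: sigmoid_def exp_minus inverse_eq_divide)
qed

lemma sigmoid_tendsto_1:
  assumes y: "y \<longlonglongrightarrow> a" "a > 0" and e: "\<And>n. e n > 0" "e \<longlonglongrightarrow> 0"
  shows "(\<lambda>n. sigmoid (e n) (y n)) \<longlonglongrightarrow> 1"
proof -
  have "filterlim (\<lambda>n. y n * inverse (e n)) at_top sequentially"
    by (rule filterlim_tendsto_pos_mult_at_top[OF y]) (use e in \<open>intro filterlim_inverse_at_top; simp\<close>)
  then have "filterlim (\<lambda>n. - (y n * inverse (e n))) at_bot sequentially"
    by (simp add: filterlim_uminus_at_bot)
  then have "(\<lambda>n. exp (- (y n * inverse (e n)))) \<longlonglongrightarrow> 0"
    by (rule filterlim_compose[OF exp_at_bot])
  then have "(\<lambda>n. 1 / (1 + exp (- (y n * inverse (e n))))) \<longlonglongrightarrow> 1 / (1 + 0)"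
    by (intro tendsto_intros) auto
  then show ?thesis by (simp add: sigmoid_def divide_inverse)
qed

lemma sigmoid_tendsto_0:
  assumes y: "y \<longlonglongrightarrow> a" "a < 0" and e: "\<And>n. e n > 0" "e \<longlonglongrightarrow> 0"
  shows "(\<lambda>n. sigmoid (e n) (y n)) \<longlonglongrightarrow> 0"
proof -
  have "(\<lambda>n. sigmoid (e n) (- y n)) \<longlonglongrightarrow> 1"
    by (rule sigmoid_tendsto_1[OF tendsto_minus[OF y(1)] _ e]) (use y in simp)
  then have "(\<lambda>n. 1 - sigmoid (e n) (- y n)) \<longlonglongrightarrow> 1 - 1" by (intro tendsto_intros)
  then show ?thesis by (simp add: sigmoid_minus)
qed

text \<open>For a non-integrable argument both bounds hold by the convention that its integral is 0.\<close>

lemma sigmoid_integral_bounds: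
  assumes "finite_measure M"
  shows "0 \<le> (LINT \<tau>|M. sigmoid e (f \<tau>))" "(LINT \<tau>|M. sigmoid e (f \<tau>)) \<le> measure M (space M)"
proof -
  interpret finite_measure M by fact
  show "0 \<le> (LINT \<tau>|M. sigmoid e (f \<tau>))" by (simp add: sigmoid_nonneg)
  show "(LINT \<tau>|M. sigmoid e (f \<tau>)) \<le> measure M (space M)"
  proof (cases "integrable M (\<lambda>\<tau>. sigmoid e (f \<tau>))")
    case True
    then have "(LINT \<tau>|M. sigmoid e (f \<tau>)) \<le> (LINT \<tau>|M. 1)"
      by (intro integral_mono) (auto simp: sigmoid_le_1)
    then show ?thesis by simp
  qed (simp add: not_integrable_integral_eq)
qed

text \<open>
  The Aumann integral contains the whole interval between \<open>M {y > 0}\<close> and \<open>M {y \<ge> 0}\<close>: a selector that is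
  a constant \<open>l \<in> [0, 1]\<close> on \<open>{y = 0}\<close> has integral \<open>M {y > 0} + l * M {y = 0}\<close>. This reduces membership
  to two real inequalities.
\<close>

lemma mem_aumann_integral_heaviside:
  assumes "finite_measure M" and [measurable]: "y \<in> borel_measurable M"
    and P: "measure M {\<tau> \<in> space M. 0 < y \<tau>} \<le> P" "P \<le> measure M {\<tau> \<in> space M. 0 \<le> y \<tau>}"
  shows "P \<in> aumann_integral M (\<lambda>\<tau>. heaviside (y \<tau>))"
proof -
  interpret finite_measure M by fact
  let ?p = "{\<tau> \<in> space M. 0 < y \<tau>}" and ?z = "{\<tau> \<in> space M. y \<tau> = 0}"
  have "{\<tau> \<in> space M. 0 \<le> y \<tau>} = ?p \<union> ?z" by auto
  then have sum: "measure M {\<tau> \<in> space M. 0 \<le> y \<tau>} = measure M ?p + measure M ?z"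
    by (simp add: finite_measure_Union disjoint_iff)
  define l where "l = (if measure M ?z = 0 then 0 else (P - measure M ?p) / measure M ?z)"
  have l: "0 \<le> l" "l \<le> 1" "measure M ?p + l * measure M ?z = P"
    using P sum measure_nonneg[of M ?z] by (auto simp: l_def field_simps)
  define s where "s \<tau> = indicator ?p \<tau> + l * indicator ?z \<tau>" for \<tau>
  have "has_bochner_integral M s (measure M ?p + l * measure M ?z)"
    unfolding s_def
    by (intro has_bochner_integral_add has_bochner_integral_mult_right has_bochner_integral_real_indicator)
      (auto simp: emeasure_finite top.not_eq_extremum[symmetric])
  then have "integrable M s" "integral\<^sup>L M s = P"
    using l by (auto simp: has_bochner_integral_iff)
  moreover have "\<forall>\<tau>\<in>space M. s \<tau> \<in> heaviside (y \<tau>)"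
    using l by (auto simp: s_def heaviside_def indicator_def)
  ultimately show ?thesis by (auto simp: aumann_integral_def)
qed

text \<open>
  Where \<open>z = 0\<close> the sigmoids need not converge, but they stay in \<open>[0, 1]\<close>. Cutting them off from above
  by the indicator of \<open>{z > 0}\<close>, or from below by that of \<open>{z \<ge> 0}\<close>, gives sequences that do
  converge everywhere to these indicators; dominated convergence yields the two bounds on \<open>P\<close>.
\<close>

lemma sigmoid_integral_limit_in_aumann:
  assumes M: "finite_measure M" and y [measurable]: "\<And>n. y n \<in> borel_measurable M"
    and lim: "\<And>\<tau>. \<tau> \<in> space M \<Longrightarrow> (\<lambda>n. y n \<tau>) \<longlonglongrightarrow> z \<tau>"
    and e: "\<And>n. e n > 0" "e \<longlonglongrightarrow> 0"
    and P: "(\<lambda>n. LINT \<tau>|M. sigmoid (e n) (y n \<tau>)) \<longlonglongrightarrow> P"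
  shows "P \<in> aumann_integral M (\<lambda>\<tau>. heaviside (z \<tau>))"
proof (rule mem_aumann_integral_heaviside[OF M])
  interpret finite_measure M by fact
  show z [measurable]: "z \<in> borel_measurable M" by (rule borel_measurable_LIMSEQ_real[OF lim y])
  have [measurable]: "sigmoid a \<in> borel_measurable borel" for a
    unfolding sigmoid_def by measurable
  have int: "integrable M (\<lambda>\<tau>. sigmoid (e n) (y n \<tau>))" for n
    by (rule integrable_const_bound[of _ 1]) (auto simp: sigmoid_nonneg sigmoid_le_1)
  let ?p = "{\<tau> \<in> space M. 0 < z \<tau>}" and ?q = "{\<tau> \<in> space M. 0 \<le> z \<tau>}"
  have "(\<lambda>n. LINT \<tau>|M. min (sigmoid (e n) (y n \<tau>)) (indicator ?p \<tau>)) \<longlonglongrightarrow> (LINT \<tau>|M. indicator ?p \<tau>)"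
  proof (rule integral_dominated_convergence[where w = "\<lambda>_. 1"])
    show "AE \<tau> in M. (\<lambda>n. min (sigmoid (e n) (y n \<tau>)) (indicator ?p \<tau>)) \<longlonglongrightarrow> indicator ?p \<tau>"
    proof (rule AE_I2)
      fix \<tau> assume \<tau>: "\<tau> \<in> space M"
      show "(\<lambda>n. min (sigmoid (e n) (y n \<tau>)) (indicator ?p \<tau>)) \<longlonglongrightarrow> indicator ?p \<tau>"
      proof (cases "0 < z \<tau>")
        case True
        then show ?thesis
          using tendsto_min[OF sigmoid_tendsto_1[OF lim[OF \<tau>] True e] tendsto_const[of 1]] \<tau> by simp
      qed (simp add: sigmoid_nonneg)
    qed
    show "AE \<tau> in M. norm (min (sigmoid (e n) (y n \<tau>)) (indicator ?p \<tau>)) \<le> 1" for n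
      by (rule AE_I2) (auto simp: sigmoid_nonneg sigmoid_le_1 min_def indicator_def)
  qed simp_all
  moreover have "(LINT \<tau>|M. min (sigmoid (e n) (y n \<tau>)) (indicator ?p \<tau>)) \<le> (LINT \<tau>|M. sigmoid (e n) (y n \<tau>))" for n
    by (intro integral_mono int integrable_const_bound[of _ 1])
      (auto simp: sigmoid_nonneg sigmoid_le_1 min_def indicator_def)
  ultimately have "(LINT \<tau>|M. indicator ?p \<tau>) \<le> P"
    using P by (intro LIMSEQ_le) auto
  then show "measure M ?p \<le> P" by simp
  have "(\<lambda>n. LINT \<tau>|M. max (sigmoid (e n) (y n \<tau>)) (indicator ?q \<tau>)) \<longlonglongrightarrow> (LINT \<tau>|M. indicator ?q \<tau>)"
  proof (rule integral_dominated_convergence[where w = "\<lambda>_. 1"])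
    show "AE \<tau> in M. (\<lambda>n. max (sigmoid (e n) (y n \<tau>)) (indicator ?q \<tau>)) \<longlonglongrightarrow> indicator ?q \<tau>"
    proof (rule AE_I2)
      fix \<tau> assume \<tau>: "\<tau> \<in> space M"
      show "(\<lambda>n. max (sigmoid (e n) (y n \<tau>)) (indicator ?q \<tau>)) \<longlonglongrightarrow> indicator ?q \<tau>"
      proof (cases "z \<tau> < 0")
        case True
        then show ?thesis
          using tendsto_max[OF sigmoid_tendsto_0[OF lim[OF \<tau>] True e] tendsto_const[of 0]] \<tau> by simp
      qed (use \<tau> in \<open>simp add: sigmoid_le_1 max_absorb2\<close>)
    qed
    show "AE \<tau> in M. norm (max (sigmoid (e n) (y n \<tau>)) (indicator ?q \<tau>)) \<le> 1" for n
      by (rule AE_I2) (auto simp: sigmoid_nonneg sigmoid_le_1 max_def indicator_def)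
  qed simp_all
  moreover have "(LINT \<tau>|M. sigmoid (e n) (y n \<tau>)) \<le> (LINT \<tau>|M. max (sigmoid (e n) (y n \<tau>)) (indicator ?q \<tau>))" for n
    by (intro integral_mono int integrable_const_bound[of _ 1])
      (auto simp: sigmoid_nonneg sigmoid_le_1 max_def indicator_def)
  ultimately have "P \<le> (LINT \<tau>|M. indicator ?q \<tau>)"
    using P by (intro LIMSEQ_le[OF P]) auto
  then show "P \<le> measure M ?q" by simp
qed

section \<open>Limits of functions and of their derivatives\<close>

text \<open>
  Uniform convergence alone says nothing about \<open>f' n t\<close>. But a difference quotient of \<open>g\<close> at \<open>t\<close> over a
  short interval is close to \<open>D\<close>; once \<open>f m\<close> is close to \<open>g\<close> relative to the length of that
  interval, its own difference quotient is close to \<open>D\<close> as well, and this quotient is a value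
  \<open>f' m \<xi>\<close> by the mean value theorem.
\<close>

lemma derivative_of_limit_approximated:
  fixes f f' :: "nat \<Rightarrow> real \<Rightarrow> real"
  assumes unif: "uniform_limit {a..b} f g sequentially" and "a < b"
    and f: "\<And>n s. s \<in> {a..b} \<Longrightarrow> (f n has_real_derivative f' n s) (at s within {a..b})"
    and g: "(g has_real_derivative D) (at t within {a..b})" and t: "t \<in> {a..b}"
  obtains m \<xi> where "filterlim m at_top sequentially" "\<And>l::nat. \<xi> l \<in> {a..b}" "\<xi> \<longlonglongrightarrow> t"
    "(\<lambda>l. f' (m l) (\<xi> l)) \<longlonglongrightarrow> D"
proof -
  have ex: "\<exists>m \<xi>. l \<le> m \<and> \<xi> \<in> {a..b} \<and> \<bar>\<xi> - t\<bar> \<le> 1 / Suc l \<and> \<bar>f' m \<xi> - D\<bar> \<le> 2 / Suc l" for l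
  proof -
    define \<eta> where "\<eta> = 1 / real (Suc l)"
    have \<eta>: "\<eta> > 0" by (simp add: \<eta>_def)
    have "((\<lambda>s. (g s - g t) / (s - t)) \<longlongrightarrow> D) (at t within {a..b})"
      using g by (simp add: has_field_derivative_iff)
    then have "\<forall>\<^sub>F s in at t within {a..b}. dist ((g s - g t) / (s - t)) D < \<eta>"
      using \<eta> by (rule tendstoD)
    moreover have "\<forall>\<^sub>F s in at t within {a..b}. s \<in> {a..b} \<and> s \<noteq> t \<and> dist s t < \<eta>"
      unfolding eventually_at using \<eta> by blast
    ultimately have "\<forall>\<^sub>F s in at t within {a..b}. dist ((g s - g t) / (s - t)) D < \<eta> \<and> s \<in> {a..b} \<and> s \<noteq> t \<and> dist s t < \<eta>"
      by (rule eventually_conj)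
    moreover have "at t within {a..b} \<noteq> bot"
      using t \<open>a < b\<close> by (simp add: trivial_limit_within islimpt_Icc)
    ultimately obtain s where s: "dist ((g s - g t) / (s - t)) D < \<eta>" "s \<in> {a..b}" "s \<noteq> t" "dist s t < \<eta>"
      using eventually_happens' by blast
    have "\<eta> * \<bar>s - t\<bar> / 2 > 0" using \<eta> s by simp
    then have "\<forall>\<^sub>F n in sequentially. \<forall>x\<in>{a..b}. dist (f n x) (g x) < \<eta> * \<bar>s - t\<bar> / 2"
      using unif by (rule uniform_limitD[rotated])
    then obtain m where m: "m \<ge> l" "\<And>x. x \<in> {a..b} \<Longrightarrow> dist (f m x) (g x) < \<eta> * \<bar>s - t\<bar> / 2"
      unfolding eventually_sequentially by (meson max.cobounded1 max.cobounded2)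
    have "\<exists>\<xi>\<in>{min s t..max s t}. f m s - f m t = f' m \<xi> * (s - t)"
    proof (cases "s < t")
      case True
      have "\<exists>\<xi>\<in>{s<..<t}. f m t - f m s = (\<lambda>h. f' m \<xi> * h) (t - s)"
      proof (rule mvt_simple[OF True])
        fix x assume "s \<le> x" "x \<le> t"
        then show "(f m has_derivative (\<lambda>h. f' m x * h)) (at x within {s..t})"
          using f[of x m] s(2) t by (auto simp: has_field_derivative_def intro: has_derivative_subset)
      qed
      then obtain \<xi> where "\<xi> \<in> {s<..<t}" "f m t - f m s = f' m \<xi> * (t - s)" by blast
      then show ?thesis using True by (intro bexI[of _ \<xi>]) (auto simp: algebra_simps)
    next
      case False
      have "\<exists>\<xi>\<in>{t<..<s}. f m s - f m t = (\<lambda>h. f' m \<xi> * h) (s - t)"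
      proof (rule mvt_simple)
        fix x assume "t \<le> x" "x \<le> s"
        then show "(f m has_derivative (\<lambda>h. f' m x * h)) (at x within {t..s})"
          using f[of x m] s(2) t by (auto simp: has_field_derivative_def intro: has_derivative_subset)
      qed (use False s in simp)
      then show ?thesis using False by auto
    qed
    then obtain \<xi> where \<xi>: "\<xi> \<in> {min s t..max s t}" "f m s - f m t = f' m \<xi> * (s - t)" by blast
    have "\<bar>f' m \<xi> - (g s - g t) / (s - t)\<bar> = \<bar>(f m s - g s) - (f m t - g t)\<bar> / \<bar>s - t\<bar>"
    proof -
      have "f' m \<xi> = (f m s - f m t) / (s - t)" using \<xi>(2) s(3) by simp
      then have "f' m \<xi> - (g s - g t) / (s - t) = ((f m s - g s) - (f m t - g t)) / (s - t)"
        by (simp add: diff_divide_distrib)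
      then show ?thesis by (simp add: abs_divide)
    qed
    also have "\<dots> \<le> \<eta>"
    proof (subst pos_divide_le_eq)
      show "\<bar>(f m s - g s) - (f m t - g t)\<bar> \<le> \<eta> * \<bar>s - t\<bar>"
        using m(2)[OF s(2)] m(2)[OF t] unfolding dist_real_def by linarith
    qed (use s(3) in simp)
    finally have "\<bar>f' m \<xi> - D\<bar> \<le> 2 * \<eta>"
      using s(1) by (simp add: dist_real_def)
    moreover have "\<xi> \<in> {a..b}" "\<bar>\<xi> - t\<bar> \<le> \<eta>"
      using \<xi>(1) s t by (auto simp: dist_real_def min_def max_def split: if_splits)
    ultimately show ?thesis using m(1) by (auto simp: \<eta>_def)
  qed
  then obtain m \<xi> where m\<xi>: "\<And>l. l \<le> m l \<and> \<xi> l \<in> {a..b} \<and> \<bar>\<xi> l - t\<bar> \<le> 1 / Suc l \<and> \<bar>f' (m l) (\<xi> l) - D\<bar> \<le> 2 / Suc l"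
    by metis
  have lim: "(\<lambda>l. C / Suc l) \<longlonglongrightarrow> 0" for C :: real
    using tendsto_mult[OF tendsto_const[of C] LIMSEQ_inverse_real_of_nat] by (simp add: divide_inverse)
  show thesis
  proof (rule that)
    show "filterlim m at_top sequentially"
      by (rule filterlim_at_top_mono[OF filterlim_ident]) (use m\<xi> in auto)
    show "\<xi> \<longlonglongrightarrow> t"
      by (rule LIM_zero_cancel, rule Lim_null_comparison[OF _ lim[of 1]]) (use m\<xi> in auto)
    show "(\<lambda>l. f' (m l) (\<xi> l)) \<longlonglongrightarrow> D"
      by (rule LIM_zero_cancel, rule Lim_null_comparison[OF _ lim[of 2]]) (use m\<xi> in auto)
  qed (use m\<xi> in auto)
qed

lemma uniform_limit_diagonal:
  fixes f :: "nat \<Rightarrow> 'a::metric_space \<Rightarrow> 'b::metric_space"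
  assumes unif: "uniform_limit S f g sequentially" and cont: "continuous_on S g"
    and m: "filterlim m at_top sequentially" and x: "\<And>l. x l \<in> S" "x \<longlonglongrightarrow> a" "a \<in> S"
  shows "(\<lambda>l. f (m l) (x l)) \<longlonglongrightarrow> g a"
proof (rule tendstoI)
  fix e :: real assume "e > 0"
  have "\<forall>\<^sub>F n in sequentially. \<forall>x\<in>S. dist (f n x) (g x) < e / 2"
    using unif \<open>e > 0\<close> by (intro uniform_limitD) auto
  then have "\<forall>\<^sub>F l in sequentially. \<forall>x\<in>S. dist (f (m l) x) (g x) < e / 2"
    using m by (rule eventually_compose_filterlim)
  moreover have "(\<lambda>l. g (x l)) \<longlonglongrightarrow> g a"
    by (rule continuous_on_tendsto_compose[OF cont x(2,3)]) (use x(1) in simp)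
  then have "\<forall>\<^sub>F l in sequentially. dist (g (x l)) (g a) < e / 2"
    using \<open>e > 0\<close> by (intro tendstoD) auto
  ultimately show "\<forall>\<^sub>F l in sequentially. dist (f (m l) (x l)) (g a) < e"
  proof eventually_elim
    case (elim l)
    then have "dist (f (m l) (x l)) (g (x l)) < e / 2" using x(1) by blast
    with elim(2) show ?case
      using dist_triangle[of "f (m l) (x l)" "g a" "g (x l)"] by linarith
  qed
qed

text \<open>
  A one-sided Gronwall inequality: the growth condition makes
  \<open>exp (- 2 K (s - a)) * (1 + \<bar>u s\<bar>\<^sup>2)\<close> nonincreasing. Only the inner product of \<open>u\<close> with its derivative
  is restricted, which lets dissipative terms of arbitrary growth be discarded.
\<close>

lemma norm_growth_bound:
  fixes u :: "real \<Rightarrow> 'a::real_inner"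
  assumes deriv: "\<And>s. s \<in> {a..b} \<Longrightarrow> (u has_vector_derivative g s) (at s within {a..b})"
    and growth: "\<And>s. s \<in> {a..b} \<Longrightarrow> u s \<bullet> g s \<le> K * (1 + (norm (u s))\<^sup>2)"
    and t: "t \<in> {a..b}"
  shows "1 + (norm (u t))\<^sup>2 \<le> exp (2 * K * (t - a)) * (1 + (norm (u a))\<^sup>2)"
proof (cases "a = t")
  case False
  then have "a < t" using t by simp
  define \<phi> where "\<phi> s = exp (- 2 * K * (s - a)) * (1 + u s \<bullet> u s)" for s
  define \<phi>' where "\<phi>' s = 2 * exp (- 2 * K * (s - a)) * (u s \<bullet> g s - K * (1 + u s \<bullet> u s))" for s
  have "\<exists>x\<in>{a<..<t}. \<phi> t - \<phi> a = (\<lambda>h. h * \<phi>' x) (t - a)"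
  proof (rule mvt_simple[OF \<open>a < t\<close>])
    fix x assume x: "a \<le> x" "x \<le> t"
    then have [derivative_intros]: "(u has_derivative (\<lambda>h. h *\<^sub>R g x)) (at x within {a..t})"
      using has_vector_derivative_within_subset[OF deriv, of x "{a..t}"] t
      by (auto simp: has_vector_derivative_def)
    show "(\<phi> has_derivative (\<lambda>h. h * \<phi>' x)) (at x within {a..t})"
      unfolding \<phi>_def
      by (rule derivative_eq_intros refl)+ (auto simp: \<phi>'_def algebra_simps inner_commute)
  qed
  then obtain x where x: "x \<in> {a<..<t}" "\<phi> t - \<phi> a = (t - a) * \<phi>' x" by blast
  have "\<phi>' x \<le> 0"
    using growth[of x] x t by (auto simp: \<phi>'_def power2_norm_eq_inner mult_le_0_iff)
  then have "\<phi> t \<le> \<phi> a" using x \<open>a < t\<close> mult_nonneg_nonpos[of "t - a" "\<phi>' x"] by linarith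
  then have "exp (2 * K * (t - a)) * \<phi> t \<le> exp (2 * K * (t - a)) * \<phi> a" by (intro mult_left_mono) auto
  then show ?thesis
    by (simp add: \<phi>_def power2_norm_eq_inner mult.assoc[symmetric] exp_add[symmetric])
qed simp

lemma Lipschitz_imp_absolutely_continuous_fun:
  assumes lip: "L-lipschitz_on {a..b} f"
  shows "absolutely_continuous_fun a b f"
  unfolding absolutely_continuous_fun_def
proof (intro allI impI)
  fix e :: real assume "e > 0"
  have L: "L \<ge> 0" by (rule lipschitz_on_nonneg[OF lip])
  show "\<exists>\<delta>>0. \<forall>S. finite S \<and> (\<forall>(p, q)\<in>S. a \<le> p \<and> p \<le> q \<and> q \<le> b) \<and>
        disjoint_family_on (\<lambda>(p, q). {p<..<q}) S \<and> (\<Sum>(p, q)\<in>S. q - p) < \<delta>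
        \<longrightarrow> (\<Sum>(p, q)\<in>S. norm (f q - f p)) < e"
  proof (intro exI[of _ "e / (L + 1)"] conjI allI impI; (elim conjE)?)
    show "e / (L + 1) > 0" using L \<open>e > 0\<close> by simp
    fix S assume S: "\<forall>(p, q)\<in>S. a \<le> p \<and> p \<le> q \<and> q \<le> b" "(\<Sum>(p, q)\<in>S. q - p) < e / (L + 1)"
    have "(\<Sum>(p, q)\<in>S. norm (f q - f p)) \<le> (\<Sum>(p, q)\<in>S. L * (q - p))"
    proof (intro sum_mono, clarify)
      fix p q assume "(p, q) \<in> S"
      then have "a \<le> p" "p \<le> q" "q \<le> b" using S(1) by auto
      then show "norm (f q - f p) \<le> L * (q - p)"
        using lipschitz_onD[OF lip, of q p] by (simp add: dist_norm)
    qed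
    also have "\<dots> = L * (\<Sum>(p, q)\<in>S. q - p)" by (simp add: sum_distrib_left case_prod_unfold)
    also have "\<dots> \<le> L * (e / (L + 1))" using S L by (intro mult_left_mono) auto
    also have "\<dots> < e" using L \<open>e > 0\<close> by (simp add: field_simps)
    finally show "(\<Sum>(p, q)\<in>S. norm (f q - f p)) < e" .
  qed
qed

section \<open>Continuity and growth of the right-hand side\<close>

lemma mk_state_nth: "mk_state x z $ i $ j = (if i = j then x i else z i j)"
  by (simp add: mk_state_def)

lemma state_tendstoI:
  "(\<And>i j. ((\<lambda>l. f l $ i $ j) \<longlongrightarrow> w $ i $ j) F) \<Longrightarrow> (f \<longlongrightarrow> (w :: 'n::finite state)) F"
  by (intro vec_tendstoI)

lemma norm_state_le:
  assumes "\<And>i j. \<bar>w $ i $ j\<bar> \<le> C i j"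
  shows "norm (w :: 'n::finite state) \<le> (\<Sum>i\<in>UNIV. \<Sum>j\<in>UNIV. C i j)"
proof -
  have "norm w \<le> (\<Sum>i\<in>UNIV. norm (w $ i))" by (simp add: norm_vec_def L2_set_le_sum)
  also have "\<dots> \<le> (\<Sum>i\<in>UNIV. \<Sum>j\<in>UNIV. \<bar>w $ i $ j\<bar>)" by (intro sum_mono norm_le_l1_cart)
  also have "\<dots> \<le> (\<Sum>i\<in>UNIV. \<Sum>j\<in>UNIV. C i j)" by (intro sum_mono assms)
  finally show ?thesis .
qed

lemma abs_state_nth_le: "\<bar>(w :: 'n::finite state) $ i $ j\<bar> \<le> norm w"
  by (metis component_le_norm_cart Finite_Cartesian_Product.norm_nth_le order_trans)

lemma bounded_linear_state_nth: "bounded_linear (\<lambda>w :: 'n::finite state. w $ i $ j)"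
  using bounded_linear_compose[OF bounded_linear_vec_nth bounded_linear_vec_nth] .

lemma continuous_on_xc: "continuous_on S f \<Longrightarrow> continuous_on S (\<lambda>s. xc (f s) i)"
  unfolding xc_def by (intro continuous_intros)

lemma locally_lipschitz_imp_continuous:
  assumes "locally_lipschitz f" shows "continuous_on UNIV f"
proof -
  have "isCont f s" for s
  proof -
    obtain \<delta> L where \<delta>: "\<delta> > 0" "L-lipschitz_on (cball s \<delta>) f"
      using assms unfolding locally_lipschitz_def by meson
    then have "continuous_on (cball s \<delta>) f" by (intro lipschitz_on_continuous_on)
    then show ?thesis
      by (rule continuous_on_interior) (use \<delta> in \<open>simp add: interior_cball\<close>)
  qed
  then show ?thesis by (simp add: continuous_at_imp_continuous_on)
qed

lemma decay_eq: "u 0 = v 0 \<Longrightarrow> decay A B u = decay A B v"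
  by (simp add: decay_def)

lemma continuous_decay:
  assumes A: "\<And>i. continuous_on UNIV (A i)" and B: "\<And>i j. i \<noteq> j \<Longrightarrow> continuous_on UNIV (B i j)"
  shows "continuous_on UNIV (\<lambda>w. decay A B (\<lambda>_. w))"
proof -
  have A': "continuous_on UNIV (\<lambda>w :: 'a state. A i (w $ i $ i))" for i
    by (rule continuous_on_compose2[OF A]) (auto intro!: continuous_intros)
  have B': "continuous_on UNIV (\<lambda>w :: 'a state. B i j (w $ i $ j))" if "i \<noteq> j" for i j
    by (rule continuous_on_compose2[OF B[OF that]]) (auto intro!: continuous_intros)
  have "continuous_on UNIV (\<lambda>w :: 'a state. if i = j then - A i (w $ i $ i) * w $ i $ i else - B i j (w $ i $ j) * w $ i $ j)" for i j
    using A' B' by (cases "i = j") (auto intro!: continuous_intros)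
  then show ?thesis
    unfolding decay_def mk_state_def xc_def zc_def by (intro continuous_on_vec_lambda)
qed

lemma continuous_input:
  assumes "\<And>i. continuous_on UNIV (J i)"
  shows "continuous_on UNIV (input J)"
  unfolding input_def mk_state_def
proof (intro continuous_on_vec_lambda)
  show "continuous_on UNIV (\<lambda>s. if i = j then J i s else 0)" for i j
    using assms by (cases "i = j") auto
qed

text \<open>Nonnegative rates make the decay dissipative, however fast \<open>A\<close> and \<open>B\<close> grow.\<close>

lemma inner_decay_nonpos:
  assumes "\<And>i s. A i s \<ge> 0" "\<And>i j s. i \<noteq> j \<Longrightarrow> B i j s \<ge> 0"
  shows "u 0 \<bullet> decay A B u \<le> 0"
proof -
  have "u 0 $ i $ j * decay A B u $ i $ j \<le> 0" for i j
  proof (cases "i = j")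
    case True
    then show ?thesis
      using mult_nonneg_nonneg[OF assms(1)[of i "u 0 $ i $ i"] zero_le_square[of "u 0 $ i $ i"]]
      by (simp add: decay_def mk_state_nth xc_def algebra_simps)
  next
    case False
    then show ?thesis
      using mult_nonneg_nonneg[OF assms(2)[OF False, of "u 0 $ i $ j"] zero_le_square[of "u 0 $ i $ j"]]
      by (simp add: decay_def mk_state_nth zc_def algebra_simps)
  qed
  then show ?thesis by (auto simp: inner_vec_def intro!: sum_nonpos)
qed

text \<open>
  Sigmoids take values in \<open>[0, 1]\<close> and the measures are finite, so the integrals are bounded by total
  masses, and the remaining factors grow at most linearly in \<open>u 0\<close>. Uniformity of the constant in
  \<open>\<epsilon>\<close> and in the past of \<open>u\<close> is what makes it usable for the whole sequence of solutions.
\<close>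

lemma sigmoid_field_linear_growth:
  fixes \<mu> :: "'n::finite \<Rightarrow> 'n \<Rightarrow> real measure"
  assumes fin: "\<And>i j. i \<noteq> j \<Longrightarrow> finite_measure (\<mu> i j)"
  obtains K where "K \<ge> 0" "\<And>\<epsilon> u. norm (sigmoid_field c d \<Gamma> \<mu> \<epsilon> u) \<le> K * (1 + norm (u 0))"
proof -
  define N where "N i j = measure (\<mu> i j) (space (\<mu> i j))" for i j
  have N: "N i j \<ge> 0" for i j by (simp add: N_def)
  define C where "C i j = (if i = j then (\<Sum>k\<in>UNIV - {i}. (1 + \<bar>c k i\<bar>) * N k i) else \<bar>d i j\<bar> * N i j)" for i j
  have int: "\<bar>LINT \<tau>|\<mu> i j. sigmoid \<epsilon> (f \<tau>)\<bar> \<le> N i j" if "i \<noteq> j" for i j \<epsilon> f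
    using sigmoid_integral_bounds[OF fin[OF that], of \<epsilon> f] by (simp add: N_def)
  have C: "C i j \<ge> 0" for i j by (auto simp: C_def N intro!: sum_nonneg mult_nonneg_nonneg)
  show thesis
  proof (rule that)
    show "(\<Sum>i\<in>UNIV. \<Sum>j\<in>UNIV. C i j) \<ge> 0" by (intro sum_nonneg C)
    fix \<epsilon> and u :: "real \<Rightarrow> 'n state"
    have "\<bar>sigmoid_field c d \<Gamma> \<mu> \<epsilon> u $ i $ j\<bar> \<le> C i j * (1 + norm (u 0))" for i j
    proof (cases "i = j")
      case True
      have "\<bar>\<Sum>k\<in>UNIV - {i}. (zc (u 0) k i - c k i) * (LINT \<tau>|\<mu> k i. sigmoid \<epsilon> (xc (u \<tau>) k - \<Gamma> k))\<bar>
         \<le> (\<Sum>k\<in>UNIV - {i}. (1 + \<bar>c k i\<bar>) * (1 + norm (u 0)) * N k i)"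
      proof (rule order_trans[OF sum_abs sum_mono])
        fix k assume k: "k \<in> UNIV - {i}"
        have "\<bar>zc (u 0) k i - c k i\<bar> \<le> norm (u 0) + \<bar>c k i\<bar>"
          using abs_state_nth_le[of "u 0" k i] by (simp add: zc_def)
        also have "\<dots> \<le> (1 + \<bar>c k i\<bar>) * (1 + norm (u 0))" by (simp add: algebra_simps)
        finally show "\<bar>(zc (u 0) k i - c k i) * (LINT \<tau>|\<mu> k i. sigmoid \<epsilon> (xc (u \<tau>) k - \<Gamma> k))\<bar>
            \<le> (1 + \<bar>c k i\<bar>) * (1 + norm (u 0)) * N k i"
          unfolding abs_mult using int[of k i \<epsilon>] k by (intro mult_mono) auto
      qed
      also have "\<dots> = C i j * (1 + norm (u 0))"
        using True by (auto simp: C_def sum_distrib_right intro!: sum.cong)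
      finally show ?thesis
        using True by (simp add: sigmoid_field_def mk_state_nth)
    next
      case False
      have "\<bar>max (xc (u 0) j) 0\<bar> \<le> 1 + norm (u 0)"
        using abs_state_nth_le[of "u 0" j j] norm_ge_zero[of "u 0"] by (auto simp: xc_def max_def)
      then have "\<bar>d i j * (LINT \<tau>|\<mu> i j. sigmoid \<epsilon> (xc (u \<tau>) i - \<Gamma> i)) * max (xc (u 0) j) 0\<bar>
         \<le> \<bar>d i j\<bar> * N i j * (1 + norm (u 0))"
        unfolding abs_mult using int[OF False, of \<epsilon>] N by (intro mult_mono) auto
      then show ?thesis using False by (simp add: sigmoid_field_def mk_state_nth C_def)
    qed
    then show "norm (sigmoid_field c d \<Gamma> \<mu> \<epsilon> u) \<le> (\<Sum>i\<in>UNIV. \<Sum>j\<in>UNIV. C i j) * (1 + norm (u 0))"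
      by (rule order_trans[OF norm_state_le]) (simp add: sum_distrib_right)
  qed
qed

section \<open>Passage to the limit in the equation\<close>

text \<open>
  The Heaviside field is a Cartesian product, so each entry may be certified by a different
  element of it. This matters because the mean value theorem provides a separate sequence of points
  for each entry of the state.
\<close>

lemma heaviside_field_componentwise:
  assumes "\<And>i j. \<exists>H\<in>heaviside_field c d \<Gamma> \<mu> u. H $ i $ j = w $ i $ j"
  shows "w \<in> heaviside_field c d \<Gamma> \<mu> u"
proof -
  have "xc w i \<in> (\<Sum>k\<in>UNIV - {i}. (zc (u 0) k i - c k i) *o
      aumann_integral (\<mu> k i) (\<lambda>\<tau>. heaviside (xc (u \<tau>) k - \<Gamma> k)))" for i
  proof -
    obtain H where "H \<in> heaviside_field c d \<Gamma> \<mu> u" "xc H i = xc w i"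
      using assms[of i i] by (auto simp: xc_def)
    then show ?thesis unfolding heaviside_field_def by (metis (mono_tags, lifting) mem_Collect_eq)
  qed
  moreover have "zc w i j \<in> (d i j * max (xc (u 0) j) 0) *o
      aumann_integral (\<mu> i j) (\<lambda>\<tau>. heaviside (xc (u \<tau>) i - \<Gamma> i))" if "i \<noteq> j" for i j
  proof -
    obtain H where "H \<in> heaviside_field c d \<Gamma> \<mu> u" "zc H i j = zc w i j"
      using assms[of i j] by (auto simp: zc_def)
    then show ?thesis using that unfolding heaviside_field_def by (metis (mono_tags, lifting) mem_Collect_eq)
  qed
  ultimately show ?thesis by (simp add: heaviside_field_def)
qed

text \<open>
  The finitely many sigmoid integrals form a bounded sequence in a finite-dimensional space, so some
  subsequence of them converges. Its limits lie in the Aumann integrals, and the field is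
  continuous in these integrals and in \<open>h n 0\<close>.
\<close>

lemma sigmoid_field_limit:
  fixes h :: "nat \<Rightarrow> real \<Rightarrow> 'n::finite state"
  assumes fin: "\<And>i j. i \<noteq> j \<Longrightarrow> finite_measure (\<mu> i j)"
    and sets: "\<And>i j. i \<noteq> j \<Longrightarrow> sets (\<mu> i j) = sets (restrict_space borel {..0})"
    and e: "\<And>n. e n > 0" "e \<longlonglongrightarrow> 0"
    and h: "\<And>n. continuous_on UNIV (h n)"
    and lim: "\<And>\<tau>. \<tau> \<le> 0 \<Longrightarrow> (\<lambda>n. h n \<tau>) \<longlonglongrightarrow> w \<tau>"
  obtains \<psi> H where "strict_mono (\<psi> :: nat \<Rightarrow> nat)"
    "(\<lambda>l. sigmoid_field c d \<Gamma> \<mu> (e (\<psi> l)) (h (\<psi> l))) \<longlonglongrightarrow> H" "H \<in> heaviside_field c d \<Gamma> \<mu> w"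
proof -
  define P where "P n a b = (LINT \<tau>|\<mu> a b. sigmoid (e n) (xc (h n \<tau>) a - \<Gamma> a))" for n a b
  \<comment> \<open>the integrals packed into one vector, with the meaningless diagonal set to 0\<close>
  define Q where "Q n = (mk_state (\<lambda>_. 0) (P n) :: 'n state)" for n
  have "bounded (range Q)"
  proof (rule boundedI)
    fix x assume "x \<in> range Q"
    then obtain n where "x = Q n" by blast
    then show "norm x \<le> (\<Sum>a\<in>UNIV. \<Sum>b\<in>UNIV. measure (\<mu> a b) (space (\<mu> a b)))"
      using sigmoid_integral_bounds[OF fin]
      by (intro norm_state_le) (auto simp: Q_def mk_state_nth P_def)
  qed
  then obtain p \<psi> where \<psi>: "strict_mono (\<psi> :: nat \<Rightarrow> nat)" and p: "(Q \<circ> \<psi>) \<longlonglongrightarrow> p"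
    using bounded_imp_convergent_subsequence by blast
  have Plim: "(\<lambda>l. P (\<psi> l) a b) \<longlonglongrightarrow> p $ a $ b" if "a \<noteq> b" for a b
    using bounded_linear.tendsto[OF bounded_linear_state_nth p, of a b] that
    by (simp add: Q_def mk_state_nth)
  have aumann: "p $ a $ b \<in> aumann_integral (\<mu> a b) (\<lambda>\<tau>. heaviside (xc (w \<tau>) a - \<Gamma> a))" if "a \<noteq> b" for a b
  proof (rule sigmoid_integral_limit_in_aumann[OF fin[OF that] _ _ _ _ Plim[OF that, unfolded P_def]])
    show "(\<lambda>\<tau>. xc (h (\<psi> l) \<tau>) a - \<Gamma> a) \<in> borel_measurable (\<mu> a b)" for l
    proof -
      have "(\<lambda>\<tau>. xc (h (\<psi> l) \<tau>) a - \<Gamma> a) \<in> borel_measurable (restrict_space borel {..0})"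
        by (intro measurable_restrict_space1 borel_measurable_continuous_onI continuous_intros continuous_on_xc h)
      then show ?thesis using measurable_cong_sets[OF sets[OF that] refl] by blast
    qed
    show "(\<lambda>l. xc (h (\<psi> l) \<tau>) a - \<Gamma> a) \<longlonglongrightarrow> xc (w \<tau>) a - \<Gamma> a" if \<tau>: "\<tau> \<in> space (\<mu> a b)" for \<tau>
    proof -
      have "\<tau> \<le> 0" using \<tau> sets_eq_imp_space_eq[OF sets[OF \<open>a \<noteq> b\<close>]] by (simp add: space_restrict_space)
      then have "(\<lambda>l. h (\<psi> l) \<tau>) \<longlonglongrightarrow> w \<tau>"
        using LIMSEQ_subseq_LIMSEQ[OF lim \<psi>] by (simp add: comp_def)
      then show ?thesis unfolding xc_def by (intro tendsto_intros)
    qed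
    show "(\<lambda>l. e (\<psi> l)) \<longlonglongrightarrow> 0" using LIMSEQ_subseq_LIMSEQ[OF e(2) \<psi>] by (simp add: comp_def)
  qed (use e in auto)
  have h0: "(\<lambda>l. h (\<psi> l) 0) \<longlonglongrightarrow> w 0"
    using LIMSEQ_subseq_LIMSEQ[OF lim[of 0] \<psi>] by (simp add: comp_def)
  define H where "H = (mk_state (\<lambda>i. \<Sum>k\<in>UNIV - {i}. (zc (w 0) k i - c k i) * p $ k $ i)
     (\<lambda>i j. d i j * p $ i $ j * max (xc (w 0) j) 0) :: 'n state)"
  show thesis
  proof (rule that[OF \<psi>])
    show "(\<lambda>l. sigmoid_field c d \<Gamma> \<mu> (e (\<psi> l)) (h (\<psi> l))) \<longlonglongrightarrow> H"
    proof (rule state_tendstoI)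
      fix i j
      show "(\<lambda>l. sigmoid_field c d \<Gamma> \<mu> (e (\<psi> l)) (h (\<psi> l)) $ i $ j) \<longlonglongrightarrow> H $ i $ j"
        unfolding sigmoid_field_def H_def mk_state_nth P_def[symmetric]
        by (cases "i = j")
          (auto simp: xc_def zc_def intro!: tendsto_intros tendsto_max Plim h0)
    qed
    have "xc H i \<in> (\<Sum>k\<in>UNIV - {i}. (zc (w 0) k i - c k i) *o
        aumann_integral (\<mu> k i) (\<lambda>\<tau>. heaviside (xc (w \<tau>) k - \<Gamma> k)))" for i
    proof -
      have "xc H i = (\<Sum>k\<in>UNIV - {i}. (zc (w 0) k i - c k i) * p $ k $ i)"
        by (simp add: H_def xc_def mk_state_nth)
      moreover have "\<forall>k\<in>UNIV - {i}. (zc (w 0) k i - c k i) * p $ k $ i \<in> (zc (w 0) k i - c k i) *o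
        aumann_integral (\<mu> k i) (\<lambda>\<tau>. heaviside (xc (w \<tau>) k - \<Gamma> k))"
        by (intro ballI set_times_intro2 aumann) simp
      ultimately show ?thesis by (subst set_sum_alt) auto
    qed
    moreover have "zc H i j \<in> (d i j * max (xc (w 0) j) 0) *o
        aumann_integral (\<mu> i j) (\<lambda>\<tau>. heaviside (xc (w \<tau>) i - \<Gamma> i))" if "i \<noteq> j" for i j
    proof -
      have "zc H i j = (d i j * max (xc (w 0) j) 0) * p $ i $ j"
        using that by (simp add: H_def zc_def mk_state_nth)
      then show ?thesis using set_times_intro2[OF aumann[OF that]] by simp
    qed
    ultimately show "H \<in> heaviside_field c d \<Gamma> \<mu> w" by (simp add: heaviside_field_def)
  qed
qed

text \<open>
  The inclusion holds at every single time at which the limit is differentiable. For each entry,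
  the derivative \<open>D\<close> of the limit is approached by entries of the derivatives of \<open>v (m l)\<close> at times
  \<open>\<xi> l\<close> near \<open>t\<close>; the histories at these times converge pointwise to the history of \<open>w\<close> at
  \<open>t\<close>, so that the right-hand sides accumulate in the right-hand side of the inclusion.
\<close>

lemma limit_derivative_in_inclusion:
  fixes v :: "nat \<Rightarrow> real \<Rightarrow> 'n::finite state"
  assumes fin: "\<And>i j. i \<noteq> j \<Longrightarrow> finite_measure (\<mu> i j)"
    and sets: "\<And>i j. i \<noteq> j \<Longrightarrow> sets (\<mu> i j) = sets (restrict_space borel {..0})"
    and A: "\<And>i. continuous_on UNIV (A i)" and B: "\<And>i j. i \<noteq> j \<Longrightarrow> continuous_on UNIV (B i j)"
    and J: "\<And>i. continuous_on UNIV (J i)"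
    and e: "\<And>n. e n > 0" "e \<longlonglongrightarrow> 0"
    and v: "\<And>n. continuous_on UNIV (v n)"
    and deriv: "\<And>n s. s \<in> {a..b} \<Longrightarrow> (v n has_vector_derivative
        (decay A B (history (v n) s) + sigmoid_field c d \<Gamma> \<mu> (e n) (history (v n) s) + input J s)) (at s within {a..b})"
    and unif: "\<And>N. N \<ge> 0 \<Longrightarrow> uniform_limit {a - N..b} v w sequentially"
    and t: "a < b" "t \<in> {a..b}" and D: "(w has_vector_derivative D) (at t within {a..b})"
  shows "D \<in> {decay A B (history w t)} + heaviside_field c d \<Gamma> \<mu> (history w t) + {input J t}"
proof -
  define G where "G n s = decay A B (history (v n) s) + sigmoid_field c d \<Gamma> \<mu> (e n) (history (v n) s) + input J s"
    for n s
  have w: "continuous_on {a - N..b} w" if "N \<ge> 0" for N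
    by (rule uniform_limit_theorem[OF _ unif[OF that]]) (auto intro!: always_eventually continuous_on_subset[OF v])
  have "\<exists>H\<in>heaviside_field c d \<Gamma> \<mu> (history w t). H $ i $ j = (D - decay A B (history w t) - input J t) $ i $ j" for i j
  proof -
    have comp: "((\<lambda>s. f s $ i $ j) has_real_derivative f' $ i $ j) F"
      if "(f has_vector_derivative f') F" for f :: "real \<Rightarrow> 'n state" and f' F
      using bounded_linear.has_vector_derivative[OF bounded_linear_state_nth that]
      by (simp add: has_real_derivative_iff_has_vector_derivative)
    have ul: "uniform_limit {a..b} (\<lambda>n s. v n s $ i $ j) (\<lambda>s. w s $ i $ j) sequentially"
      using bounded_linear.uniform_limit[OF bounded_linear_state_nth unif[of 0]] by simp
    have dr: "((\<lambda>s. v n s $ i $ j) has_real_derivative G n s $ i $ j) (at s within {a..b})"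
      if "s \<in> {a..b}" for n s
      unfolding G_def by (rule comp[OF deriv[OF that]])
    obtain m \<xi> where m: "filterlim m at_top sequentially" and \<xi>: "\<And>l. \<xi> l \<in> {a..b}" "\<xi> \<longlonglongrightarrow> t"
      and lim: "(\<lambda>l. G (m l) (\<xi> l) $ i $ j) \<longlonglongrightarrow> D $ i $ j"
      using derivative_of_limit_approximated[OF ul t(1) dr comp[OF D] t(2)] by blast
    have conv: "(\<lambda>l. history (v (m l)) (\<xi> l) \<tau>) \<longlonglongrightarrow> history w t \<tau>" if "\<tau> \<le> 0" for \<tau>
      unfolding history_def
    proof (rule uniform_limit_diagonal[OF unif w m])
      show "\<xi> l + \<tau> \<in> {a - (- \<tau>)..b}" for l using \<xi>(1)[of l] that by auto
      show "(\<lambda>l. \<xi> l + \<tau>) \<longlonglongrightarrow> t + \<tau>" by (intro tendsto_intros \<xi>)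
    qed (use that t in auto)
    have hist: "continuous_on UNIV (history (v n) s)" for n s
      unfolding history_def by (rule continuous_on_compose2[OF v]) (auto intro!: continuous_intros)
    have em: "(\<lambda>l. e (m l)) \<longlonglongrightarrow> 0" by (rule filterlim_compose[OF e(2) m])
    obtain \<psi> H where \<psi>: "strict_mono (\<psi> :: nat \<Rightarrow> nat)"
      and H: "(\<lambda>l. sigmoid_field c d \<Gamma> \<mu> (e (m (\<psi> l))) (history (v (m (\<psi> l))) (\<xi> (\<psi> l)))) \<longlonglongrightarrow> H"
        "H \<in> heaviside_field c d \<Gamma> \<mu> (history w t)"
      by (rule sigmoid_field_limit[where \<mu> = \<mu> and c = c and d = d and \<Gamma> = \<Gamma> and e = "\<lambda>l. e (m l)"
            and h = "\<lambda>l. history (v (m l)) (\<xi> l)" and w = "history w t"])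
        (use fin sets e(1) em hist conv in auto)
    have sub: "filterlim \<psi> at_top sequentially" by (rule filterlim_subseq[OF \<psi>])
    have "(\<lambda>l. decay A B (\<lambda>_. history (v (m l)) (\<xi> l) 0)) \<longlonglongrightarrow> decay A B (\<lambda>_. history w t 0)"
      by (rule continuous_on_tendsto_compose[OF continuous_decay[OF A B] conv]) auto
    then have dec: "(\<lambda>l. decay A B (history (v (m l)) (\<xi> l))) \<longlonglongrightarrow> decay A B (history w t)"
      by (simp add: decay_def)
    have inp: "(\<lambda>l. input J (\<xi> l)) \<longlonglongrightarrow> input J t"
      by (rule continuous_on_tendsto_compose[OF continuous_input[OF J] \<xi>(2)]) auto
    have "(\<lambda>l. G (m (\<psi> l)) (\<xi> (\<psi> l))) \<longlonglongrightarrow> decay A B (history w t) + H + input J t"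
      unfolding G_def
      by (intro tendsto_add H filterlim_compose[OF dec sub] filterlim_compose[OF inp sub])
    then have "(\<lambda>l. G (m (\<psi> l)) (\<xi> (\<psi> l)) $ i $ j) \<longlonglongrightarrow> (decay A B (history w t) + H + input J t) $ i $ j"
      by (rule bounded_linear.tendsto[OF bounded_linear_state_nth])
    then have "D $ i $ j = (decay A B (history w t) + H + input J t) $ i $ j"
      using filterlim_compose[OF lim sub] LIMSEQ_unique by blast
    then show ?thesis using H(2) by (intro bexI[of _ H]) auto
  qed
  then have "D - decay A B (history w t) - input J t \<in> heaviside_field c d \<Gamma> \<mu> (history w t)"
    by (rule heaviside_field_componentwise)
  moreover have "D = decay A B (history w t) + (D - decay A B (history w t) - input J t) + input J t" by simp
  ultimately show ?thesis by (metis set_plus_intro singletonI)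
qed

section \<open>Convergence of initial data and uniform estimates for solutions\<close>

lemma C_space_diff:
  assumes "u \<in> C_space \<gamma>" "v \<in> C_space \<gamma>"
  shows "(\<lambda>s. u s - v s) \<in> C_space \<gamma>"
proof -
  obtain a b where "((\<lambda>t. exp (\<gamma> * t) *\<^sub>R u t) \<longlongrightarrow> a) at_bot" "((\<lambda>t. exp (\<gamma> * t) *\<^sub>R v t) \<longlongrightarrow> b) at_bot"
    using assms by (auto simp: C_space_def)
  then have "((\<lambda>t. exp (\<gamma> * t) *\<^sub>R (u t - v t)) \<longlongrightarrow> a - b) at_bot"
    unfolding scaleR_diff_right by (rule tendsto_diff)
  then show ?thesis
    using assms by (auto simp: C_space_def intro: continuous_on_diff)
qed

text \<open>
  The supremum that defines \<^const>\<open>C_norm\<close> is finite: the weighted function has a limit at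
  \<open>-\<infinity>\<close> and is continuous on the remaining compact interval.
\<close>

lemma C_norm_upper:
  assumes u: "u \<in> C_space \<gamma>" and "s \<le> 0"
  shows "exp (\<gamma> * s) * infnorm (u s) \<le> C_norm \<gamma> u"
  unfolding C_norm_def
proof (rule cSUP_upper)
  let ?f = "\<lambda>t. exp (\<gamma> * t) *\<^sub>R u t"
  obtain l where "(?f \<longlongrightarrow> l) at_bot" and cont: "continuous_on {..0} u"
    using u by (auto simp: C_space_def)
  then have "\<forall>\<^sub>F t in at_bot. dist (?f t) l < 1" by (intro tendstoD) auto
  then obtain a where a: "\<And>t. t \<le> a \<Longrightarrow> dist (?f t) l < 1"
    by (auto simp: eventually_at_bot_linorder)
  have "continuous_on {a..0} ?f"
    by (intro continuous_intros continuous_on_subset[OF cont]) auto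
  then have "bounded (?f ` {a..0})" by (intro compact_imp_bounded compact_continuous_image) auto
  then obtain K where K: "\<And>t. t \<in> {a..0} \<Longrightarrow> norm (?f t) \<le> K"
    unfolding bounded_iff by blast
  have "exp (\<gamma> * t) * infnorm (u t) \<le> max K (norm l + 1)" if "t \<le> 0" for t
  proof -
    have "exp (\<gamma> * t) * infnorm (u t) \<le> norm (?f t)" by (simp add: infnorm_le_norm)
    also have "\<dots> \<le> max K (norm l + 1)"
    proof (cases "t \<le> a")
      case True
      have "norm (?f t) \<le> norm l + dist (?f t) l" using norm_triangle_ineq[of l "?f t - l"] by (simp add: dist_norm)
      then show ?thesis using a[OF True] by linarith
    qed (use K[of t] that in simp)
    finally show ?thesis .
  qed
  then show "bdd_above ((\<lambda>t. exp (\<gamma> * t) * infnorm (u t)) ` {..0})" by (intro bdd_aboveI2) auto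
qed (use \<open>s \<le> 0\<close> in simp)

lemma C_norm_tendsto_imp_uniform_limit:
  assumes "\<gamma> \<ge> 0" and um: "\<And>m. um m \<in> C_space \<gamma>" and u: "u \<in> C_space \<gamma>"
    and conv: "(\<lambda>m. C_norm \<gamma> (\<lambda>s. um m s - u s)) \<longlonglongrightarrow> 0"
  shows "uniform_limit {- N..0} um (u :: real \<Rightarrow> 'n::finite state) sequentially"
proof (rule uniform_limitI)
  fix e :: real assume "e > 0"
  define K where "K = sqrt DIM('n state) * exp (\<gamma> * N)"
  have bound: "dist (um m s) (u s) \<le> K * C_norm \<gamma> (\<lambda>s. um m s - u s)" if "s \<in> {- N..0}" for m s
  proof -
    let ?w = "\<lambda>s. um m s - u s"
    have "1 \<le> exp (\<gamma> * N) * exp (\<gamma> * s)"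
      using that \<open>\<gamma> \<ge> 0\<close> by (simp add: exp_add[symmetric] distrib_left[symmetric])
    then have "infnorm (?w s) \<le> (exp (\<gamma> * N) * exp (\<gamma> * s)) * infnorm (?w s)"
      using mult_right_mono[of 1 _ "infnorm (?w s)"] by (simp add: infnorm_pos_le)
    also have "\<dots> \<le> exp (\<gamma> * N) * C_norm \<gamma> ?w"
      using C_norm_upper[OF C_space_diff[OF um u], of s m] that by simp
    finally have "sqrt DIM('n state) * infnorm (?w s) \<le> sqrt DIM('n state) * (exp (\<gamma> * N) * C_norm \<gamma> ?w)"
      by (rule mult_left_mono) simp
    then show ?thesis
      using norm_le_infnorm[of "?w s"] unfolding dist_norm K_def mult.assoc by (rule order_trans[rotated])
  qed
  have "(\<lambda>m. K * C_norm \<gamma> (\<lambda>s. um m s - u s)) \<longlonglongrightarrow> K * 0" by (intro tendsto_intros conv)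
  then have "\<forall>\<^sub>F m in sequentially. K * C_norm \<gamma> (\<lambda>s. um m s - u s) < e"
    using \<open>e > 0\<close> by (intro order_tendstoD(2)) auto
  then show "\<forall>\<^sub>F m in sequentially. \<forall>s\<in>{- N..0}. dist (um m s) (u s) < e"
  proof eventually_elim
    case (elim m)
    then show ?case using bound[of _ m] by (meson le_less_trans)
  qed
qed

text \<open>The weight is at least 1 on \<open>(-\<infinity>, 0]\<close>.\<close>

lemma finite_measure_of_exponential_moment:
  assumes sets: "sets M = sets (restrict_space borel {..0})" and "\<gamma> \<ge> 0"
    and fin: "(\<integral>\<^sup>+ t. ennreal (exp (- \<gamma> * t)) \<partial>M) < \<infinity>"
  shows "finite_measure M"
proof (rule finite_measureI)
  have "space M = {..0}" using sets_eq_imp_space_eq[OF sets] by (simp add: space_restrict_space)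
  then have "(\<integral>\<^sup>+ t. 1 \<partial>M) \<le> (\<integral>\<^sup>+ t. ennreal (exp (- \<gamma> * t)) \<partial>M)"
    using \<open>\<gamma> \<ge> 0\<close> by (intro nn_integral_mono) (simp add: mult_nonneg_nonpos)
  then have "emeasure M (space M) < \<infinity>" using fin by simp
  then show "emeasure M (space M) \<noteq> \<infinity>" by simp
qed

text \<open>
  The decay contributes nonpositively to \<open>u \<bullet> u'\<close>, and the other two terms grow at most linearly, so the
  Gronwall estimate applies with a constant common to all \<open>m\<close>. On the resulting ball and the
  compact time interval all three terms of the equation are bounded, and this bounds the Lipschitz
  constants.
\<close>

lemma sigmoid_solutions_bounded_equi_Lipschitz:
  fixes u :: "'i \<Rightarrow> real \<Rightarrow> 'n::finite state"
  assumes fin: "\<And>i j. i \<noteq> j \<Longrightarrow> finite_measure (\<mu> i j)"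
    and A: "\<And>i. continuous_on UNIV (A i)" "\<And>i s. A i s \<ge> 0"
    and B: "\<And>i j. i \<noteq> j \<Longrightarrow> continuous_on UNIV (B i j)" "\<And>i j s. i \<noteq> j \<Longrightarrow> B i j s \<ge> 0"
    and J: "\<And>i. continuous_on UNIV (J i)"
    and sol: "\<And>m. sigmoid_solution A B J c d \<Gamma> \<mu> (\<epsilon> m) a (v m) (u m)"
    and init: "\<And>m. norm (u m a) \<le> R"
  obtains N L where "\<And>m t. t \<in> {a..b} \<Longrightarrow> norm (u m t) \<le> N" "\<And>m. L-lipschitz_on {a..b} (u m)"
proof -
  define G where "G m s = decay A B (history (u m) s) + sigmoid_field c d \<Gamma> \<mu> (\<epsilon> m) (history (u m) s) + input J s"
    for m s
  have deriv: "(u m has_vector_derivative G m s) (at s within {a..b})" if "s \<in> {a..b}" for m s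
    using sol[of m] that unfolding sigmoid_solution_def G_def
    by (auto intro: has_vector_derivative_within_subset[where S = "{a..}"])
  have hist0: "history (u m) s 0 = u m s" for m s by (simp add: history_def)
  obtain K where K: "K \<ge> 0" "\<And>\<epsilon> u. norm (sigmoid_field c d \<Gamma> \<mu> \<epsilon> u) \<le> K * (1 + norm (u 0))"
    using sigmoid_field_linear_growth[where \<mu> = \<mu> and c = c and d = d and \<Gamma> = \<Gamma>, OF fin] by blast
  have "continuous_on UNIV (input J)"
    by (rule continuous_input[OF J])
  then have "bounded (input J ` {a..b})"
    by (intro compact_imp_bounded compact_continuous_image) (auto intro: continuous_on_subset)
  then obtain Q where Q: "Q > 0" "\<And>s. s \<in> {a..b} \<Longrightarrow> norm (input J s) \<le> Q"
    unfolding bounded_pos by auto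
  have sq: "x \<le> 1 + x\<^sup>2" for x :: real
    using zero_le_power2[of "x - 1 / 2"] by (simp add: power2_eq_square algebra_simps)
  have growth: "u m s \<bullet> G m s \<le> 2 * (K + Q) * (1 + (norm (u m s))\<^sup>2)" if s: "s \<in> {a..b}" for m s
  proof -
    let ?n = "norm (u m s)"
    have "u m s \<bullet> decay A B (history (u m) s) \<le> 0"
      using inner_decay_nonpos[of A B "history (u m) s"] A B by (simp add: hist0)
    moreover have "u m s \<bullet> sigmoid_field c d \<Gamma> \<mu> (\<epsilon> m) (history (u m) s) \<le> ?n * (K * (1 + ?n))"
      using K(2)[of "\<epsilon> m" "history (u m) s"] unfolding hist0
      by (intro order_trans[OF norm_cauchy_schwarz mult_left_mono]) auto
    moreover have "u m s \<bullet> input J s \<le> ?n * (Q * (1 + ?n))"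
    proof (intro order_trans[OF norm_cauchy_schwarz mult_left_mono])
      show "norm (input J s) \<le> Q * (1 + ?n)"
        using Q(2)[OF s] Q(1) by (simp add: distrib_left add_increasing2)
    qed simp
    ultimately have "u m s \<bullet> G m s \<le> (K + Q) * (?n * (1 + ?n))"
      by (simp add: G_def inner_add_right algebra_simps)
    also have "\<dots> \<le> (K + Q) * (2 * (1 + ?n\<^sup>2))"
    proof (rule mult_left_mono)
      show "?n * (1 + ?n) \<le> 2 * (1 + ?n\<^sup>2)"
        using sq[of ?n] by (simp add: power2_eq_square distrib_left)
    qed (use K Q in simp)
    finally show ?thesis by (simp add: algebra_simps)
  qed
  define N where "N = exp (2 * (2 * (K + Q)) * (b - a)) * (1 + R\<^sup>2)"
  have N: "norm (u m t) \<le> N" if t: "t \<in> {a..b}" for m t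
  proof -
    have "norm (u m t) \<le> 1 + (norm (u m t))\<^sup>2"
      by (rule sq)
    also have "\<dots> \<le> exp (2 * (2 * (K + Q)) * (t - a)) * (1 + (norm (u m a))\<^sup>2)"
      by (rule norm_growth_bound[OF deriv growth t])
    also have "\<dots> \<le> N"
      unfolding N_def using t K(1) Q(1) init[of m]
      by (intro mult_mono add_left_mono power_mono) auto
    finally show ?thesis .
  qed
  have "bounded ((\<lambda>w. decay A B (\<lambda>_. w)) ` cball 0 N)"
    by (intro compact_imp_bounded compact_continuous_image continuous_on_subset[OF continuous_decay[OF A(1) B(1)]]) auto
  then obtain Q' where Q': "Q' > 0" "\<And>w. norm w \<le> N \<Longrightarrow> norm (decay A B (\<lambda>_. w)) \<le> Q'"
    unfolding bounded_pos by auto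
  define L where "L = Q' + K * (1 + \<bar>N\<bar>) + Q"
  have "norm (G m s) \<le> L" if s: "s \<in> {a..b}" for m s
  proof -
    have "norm (decay A B (history (u m) s)) \<le> Q'"
      using Q'(2)[OF N[OF s, of m]] decay_eq[of "history (u m) s" "\<lambda>_. u m s" A B] by (simp add: hist0)
    moreover have "norm (sigmoid_field c d \<Gamma> \<mu> (\<epsilon> m) (history (u m) s)) \<le> K * (1 + \<bar>N\<bar>)"
      using N[OF s, of m] K(1)
      by (intro order_trans[OF K(2)] mult_left_mono) (auto simp: hist0)
    ultimately show ?thesis
      using Q(2)[OF s] unfolding G_def L_def by (intro norm_triangle_le add_mono) auto
  qed
  moreover have "L \<ge> 0" using Q'(1) K(1) Q(1) by (simp add: L_def)
  ultimately have "L-lipschitz_on {a..b} (u m)" for m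
    using deriv unfolding has_vector_derivative_def
    by (intro bounded_derivative_imp_lipschitz[where f' = "\<lambda>s h. h *\<^sub>R G m s"] onorm_bound)
      (auto simp: mult.commute[of L] intro!: mult_left_mono)
  with N show thesis by (rule that)
qed

section \<open>Convergence of sigmoidal solutions to a Heaviside solution\<close>

theorem corollary3p13:
  fixes A J :: "'n::finite \<Rightarrow> real \<Rightarrow> real"
    and B :: "'n \<Rightarrow> 'n \<Rightarrow> real \<Rightarrow> real"
    and c d :: "'n \<Rightarrow> 'n \<Rightarrow> real"
    and \<Gamma> :: "'n \<Rightarrow> real"
    and \<mu> :: "'n \<Rightarrow> 'n \<Rightarrow> real measure"
    and \<gamma> T r t0 :: real
    and \<epsilon> :: "nat \<Rightarrow> real"
    and u0 :: "real \<Rightarrow> 'n state"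
    and u0m u :: "nat \<Rightarrow> real \<Rightarrow> 'n state"
  assumes gamma: "\<gamma> > 0"
    and cd: "\<And>i j. i \<noteq> j \<Longrightarrow> c i j \<ge> 0 \<and> d i j \<ge> 0"
    and mu: "\<And>i j. i \<noteq> j \<Longrightarrow> regular_borel_measure (\<mu> i j)"
    and D_lipschitz: "\<And>i. locally_lipschitz (A i)"
      "\<And>i j. i \<noteq> j \<Longrightarrow> locally_lipschitz (B i j)"
    and D_bound: "\<exists>\<alpha>>0. (\<forall>i s. A i s \<ge> \<alpha>) \<and> (\<forall>i j s. i \<noteq> j \<longrightarrow> B i j s \<ge> \<alpha>)"
    and M: "\<And>i j. i \<noteq> j \<Longrightarrow> (\<integral>\<^sup>+ t. ennreal (exp (- \<gamma> * t)) \<partial>\<mu> i j) < \<infinity>"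
    and I: "\<And>i. continuous_on UNIV (J i)"
    and T: "T > 0" and r: "r > 0"
    and eps: "\<And>m. \<epsilon> m \<in> {0<..1/5}" "decseq \<epsilon>" "\<epsilon> \<longlonglongrightarrow> 0"
    and u0m: "\<And>m. u0m m \<in> C_cball \<gamma> r"
    and u0: "u0 \<in> C_space \<gamma>"
    and u0m_conv: "(\<lambda>m. C_norm \<gamma> (\<lambda>s. u0m m s - u0 s)) \<longlonglongrightarrow> 0"
    and sol: "\<And>m. sigmoid_solution A B J c d \<Gamma> \<mu> (\<epsilon> m) t0 (u0m m) (u m)"
  shows "\<exists>\<phi> ustar. strict_mono (\<phi> :: nat \<Rightarrow> nat) \<and>
           continuous_on {t0..t0 + T} ustar \<and>
           uniform_limit {t0..t0 + T} (\<lambda>k. u (\<phi> k)) ustar sequentially \<and>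
           heaviside_solution A B J c d \<Gamma> \<mu> t0 T u0 ustar"
proof -
  define t1 where "t1 = t0 + T"
  have t01: "t0 < t1" using T by (simp add: t1_def)
  have sets: "sets (\<mu> i j) = sets (restrict_space borel {..0})" if "i \<noteq> j" for i j
    using mu[OF that] by (simp add: regular_borel_measure_def)
  have fin: "finite_measure (\<mu> i j)" if "i \<noteq> j" for i j
    by (rule finite_measure_of_exponential_moment[OF sets[OF that] _ M[OF that]]) (use gamma in simp)
  obtain \<alpha> where "\<alpha> > 0" and \<alpha>: "\<And>i s. A i s \<ge> \<alpha>" "\<And>i j s. i \<noteq> j \<Longrightarrow> B i j s \<ge> \<alpha>"
    using D_bound by blast
  have A: "continuous_on UNIV (A i)" "A i s \<ge> 0" for i s
    using locally_lipschitz_imp_continuous[OF D_lipschitz(1)] \<alpha>(1)[of i s] \<open>\<alpha> > 0\<close> by auto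
  have B: "continuous_on UNIV (B i j)" "B i j s \<ge> 0" if "i \<noteq> j" for i j s
    using locally_lipschitz_imp_continuous[OF D_lipschitz(2)[OF that]] \<alpha>(2)[OF that, of s] \<open>\<alpha> > 0\<close> by auto
  have u_past: "u m s = u0m m (s - t0)" if "s \<le> t0" for m s
    using sol[of m] that unfolding sigmoid_solution_def history_def
    by (metis add.commute diff_add_cancel diff_le_0_iff_le)
  have u0m_unif: "uniform_limit {- N..0} u0m u0 sequentially" for N
    by (rule C_norm_tendsto_imp_uniform_limit[OF _ _ u0 u0m_conv]) (use gamma u0m in \<open>auto simp: C_cball_def\<close>)
  have u0m_0: "(\<lambda>m. u0m m 0) \<longlonglongrightarrow> u0 0"
    by (rule tendsto_uniform_limitI[OF u0m_unif[of 0]]) simp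
  then have "Bseq (\<lambda>m. u0m m 0)" by (rule convergent_imp_Bseq[OF convergentI])
  then obtain R where R: "\<And>m. norm (u m t0) \<le> R"
    using u_past[of t0] by (auto elim!: BseqE)
  obtain N L where N: "\<And>m t. t \<in> {t0..t1} \<Longrightarrow> norm (u m t) \<le> N" and L: "\<And>m. L-lipschitz_on {t0..t1} (u m)"
    by (rule sigmoid_solutions_bounded_equi_Lipschitz[where \<mu> = \<mu> and A = A and B = B and J = J and c = c and d = d
          and \<Gamma> = \<Gamma> and \<epsilon> = \<epsilon> and v = u0m and u = u and a = t0 and b = t1 and R = R])
      (use fin A B I sol R in auto)
  have L0: "L \<ge> 0" by (rule lipschitz_on_nonneg[OF L[of 0]])
  have equi: "\<exists>\<delta>>0. \<forall>n y. y \<in> {t0..t1} \<and> norm (x - y) < \<delta> \<longrightarrow> norm (u n x - u n y) < e"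
    if "x \<in> {t0..t1}" "e > 0" for x e
  proof (intro exI[of _ "e / (L + 1)"] conjI allI impI)
    show "e / (L + 1) > 0" using L0 that by simp
    fix n y assume y: "y \<in> {t0..t1} \<and> norm (x - y) < e / (L + 1)"
    have "norm (u n x - u n y) \<le> L * norm (x - y)"
      using lipschitz_onD[OF L that(1), of y n] y by (simp add: dist_norm)
    also have "\<dots> \<le> L * (e / (L + 1))" using L0 y by (intro mult_left_mono) auto
    also have "\<dots> < e" using L0 that by (simp add: field_simps)
    finally show "norm (u n x - u n y) < e" .
  qed
  obtain g \<phi> where g: "continuous_on {t0..t1} g" and \<phi>: "strict_mono (\<phi> :: nat \<Rightarrow> nat)"
    and g_lim: "\<And>e. 0 < e \<Longrightarrow> \<exists>k0. \<forall>k x. k \<ge> k0 \<and> x \<in> {t0..t1} \<longrightarrow> norm (u (\<phi> k) x - g x) < e"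
    using Arzela_Ascoli[of "{t0..t1}" u N, OF compact_Icc N equi] by blast
  have \<phi>_top: "filterlim \<phi> at_top sequentially" by (rule filterlim_subseq[OF \<phi>])
  have g_unif: "uniform_limit {t0..t1} (\<lambda>k. u (\<phi> k)) g sequentially"
    using g_lim unfolding uniform_limit_sequentially_iff dist_norm by meson
  define ustar where "ustar t = (if t \<le> t0 then u0 (t - t0) else g t)" for t
  have "(\<lambda>k. u (\<phi> k) t0) \<longlonglongrightarrow> g t0"
    by (rule tendsto_uniform_limitI[OF g_unif]) (use t01 in simp)
  moreover have "(\<lambda>k. u (\<phi> k) t0) \<longlonglongrightarrow> u0 0"
    using filterlim_compose[OF u0m_0 \<phi>_top] by (simp add: u_past)
  ultimately have "g t0 = u0 0" by (rule LIMSEQ_unique)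
  then have ustar_g: "ustar t = g t" if "t \<in> {t0..t1}" for t
    using that by (auto simp: ustar_def)
  have unif: "uniform_limit {t0..t1} (\<lambda>k. u (\<phi> k)) ustar sequentially"
    using g_unif by (rule uniform_limit_cong'[THEN iffD1, rotated -1]) (auto simp: ustar_g)
  \<comment> \<open>the delay terms look at the whole past, so convergence is needed to the left of \<open>t0\<close> too\<close>
  have unif_past: "uniform_limit {t0 - N..t1} (\<lambda>k. u (\<phi> k)) ustar sequentially" if "N \<ge> 0" for N
  proof -
    have "uniform_limit {- N..0} (\<lambda>k. u0m (\<phi> k)) u0 sequentially"
      by (rule filterlim_compose[OF u0m_unif \<phi>_top])
    then have "uniform_limit {t0 - N..t0} (\<lambda>k s. u0m (\<phi> k) (s - t0)) (\<lambda>s. u0 (s - t0)) sequentially"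
      by (rule uniform_limit_compose') auto
    then have "uniform_limit {t0 - N..t0} (\<lambda>k. u (\<phi> k)) ustar sequentially"
      by (rule uniform_limit_cong'[THEN iffD1, rotated -1]) (auto simp: u_past ustar_def)
    then have "uniform_limit ({t0 - N..t0} \<union> {t0..t1}) (\<lambda>k. u (\<phi> k)) ustar sequentially"
      by (rule uniform_limit_on_Un[OF _ unif])
    also have "{t0 - N..t0} \<union> {t0..t1} = {t0 - N..t1}" using that t01 by auto
    finally show ?thesis .
  qed
  have lip: "L-lipschitz_on {t0..t1} ustar"
  proof (rule lipschitz_onI[OF _ L0])
    fix s t assume st: "s \<in> {t0..t1}" "t \<in> {t0..t1}"
    have "(\<lambda>k. dist (u (\<phi> k) s) (u (\<phi> k) t)) \<longlonglongrightarrow> dist (ustar s) (ustar t)"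
      by (intro tendsto_dist tendsto_uniform_limitI[OF unif] st)
    then show "dist (ustar s) (ustar t) \<le> L * dist s t"
      by (rule LIMSEQ_le_const2) (use lipschitz_onD[OF L st] in auto)
  qed
  have deriv: "(u m has_vector_derivative
        (decay A B (history (u m) s) + sigmoid_field c d \<Gamma> \<mu> (\<epsilon> m) (history (u m) s) + input J s)) (at s within {t0..t1})"
    if "s \<in> {t0..t1}" for m s
    using sol[of m] that unfolding sigmoid_solution_def
    by (auto intro: has_vector_derivative_within_subset[where S = "{t0..}"])
  have "heaviside_solution A B J c d \<Gamma> \<mu> t0 T u0 ustar"
    unfolding heaviside_solution_def t1_def[symmetric]
  proof (intro conjI allI impI)
    show "history ustar t0 s = u0 s" if "s \<le> 0" for s using that by (simp add: history_def ustar_def)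
    show "absolutely_continuous_fun t0 t1 ustar" by (rule Lipschitz_imp_absolutely_continuous_fun[OF lip])
    show "AE t in lebesgue. t \<in> {t0..t1} \<longrightarrow> (\<exists>D. (ustar has_vector_derivative D) (at t within {t0..t1}) \<and>
             D \<in> {decay A B (history ustar t)} + heaviside_field c d \<Gamma> \<mu> (history ustar t) + {input J t})"
      using Lipschitz_differentiable_AE[OF lip]
    proof (rule AE_mp, intro AE_I2 impI)
      fix t assume "t \<in> {t0..t1} \<longrightarrow> ustar differentiable (at t within {t0..t1})" and t: "t \<in> {t0..t1}"
      then obtain D where D: "(ustar has_vector_derivative D) (at t within {t0..t1})"
        using vector_derivative_works by blast
      have "D \<in> {decay A B (history ustar t)} + heaviside_field c d \<Gamma> \<mu> (history ustar t) + {input J t}"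
      proof (rule limit_derivative_in_inclusion[where v = "\<lambda>k. u (\<phi> k)" and e = "\<lambda>k. \<epsilon> (\<phi> k)"])
        show "\<epsilon> (\<phi> k) > 0" for k using eps(1)[of "\<phi> k"] by simp
        show "(\<lambda>k. \<epsilon> (\<phi> k)) \<longlonglongrightarrow> 0" by (rule filterlim_compose[OF eps(3) \<phi>_top])
        show "continuous_on UNIV (u (\<phi> k))" for k using sol[of "\<phi> k"] by (simp add: sigmoid_solution_def)
      qed (use fin sets A B I deriv unif_past t01 t D in auto)
      with D show "\<exists>D. (ustar has_vector_derivative D) (at t within {t0..t1}) \<and>
             D \<in> {decay A B (history ustar t)} + heaviside_field c d \<Gamma> \<mu> (history ustar t) + {input J t}" by blast
    qed
  qed
  then show ?thesis
    using \<phi> unif lipschitz_on_continuous_on[OF lip] unfolding t1_def by blast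
qed

end
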